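(* Suppose $G_{t'}\sim\mathcal G(n,p(t'))$ for all $t'\in\mathcal T$ with $p_{\min}:=\min_{t'\in\mathcal T}p(t')>0$. Let $t\in[0,1]$ and suppose $n\gtrsim\log n$. Choose $$\delta=\min\left\{\frac{(b(t))^{2/3}}{(2M)^{2/3}\,n\,(Lp_{\min})^{1/3}}\,T^{2/3},\;T\right\}\qquad\text{and}\qquad d_\delta(t)=3np_\delta(t).$$ If $T$ is such that $\delta\gtrsim\frac{\log n}{p_{\min}}$ and $$\sqrt{\frac{\log n}{Lnp_{\min}}}\max\left\{\frac{(2M)^{1/3}n^{1/2}(Lp_{\min})^{1/6}}{b^{1/3}(t)\,T^{1/3}},\frac1{\sqrt T}\right\}+Mn\min\left\{\frac{b^{2/3}(t)}{(2M)^{2/3}n(Lp_{\min})^{1/3}T^{1/3}},1\right\}\lesssim\frac1{b^{7/2}(t)},$$ then with probability at least $1-O(n^{-10})$, $$\frac{\|\hat\pi(t)-\pi^*(t)\|_2}{\|\pi^*(t)\|_2}\lesssim Mn\,b^{7/2}(t)\min\left\{\frac{b^{2/3}(t)}{(2M)^{2/3}n(Lp_{\min})^{1/3}T^{1/3}},1\right\}+\frac{b^{9/2}(t)}{\sqrt{Lnp_{\min}}}\max\left\{\frac{(2M)^{1/3}n^{1/2}(Lp_{\min})^{1/6}}{b^{1/3}(t)\,T^{1/3}},\frac1{\sqrt T}\right\}.$$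
   Context: Dynamic BTL model. Let $n\ge 2$, $T\ge 1$, $L\ge 1$ be integers, $[n]=\{1,\dots,n\}$. For each $t\in[0,1]$ let $w_t^*\in\mathbb R^n$ have strictly positive entries $w^*_{t,i}$, and for $i\ne j$ put $y^*_{ij}(t)=\frac{w^*_{t,j}}{w^*_{t,i}+w^*_{t,j}}$. Smoothness assumption: there is $M\ge0$ with $|y^*_{ij}(t)-y^*_{ij}(t')|\le M|t-t'|$ for all $t,t'\in[0,1]$ and $i\ne j$. Grid: $\mathcal T=\{i/T: i=0,\dots,T\}$. For each $t'\in\mathcal T$ there is an undirected comparison graph $G_{t'}=([n],\mathcal E_{t'})$. Given the graphs, for each $t'\in\mathcal T$, $\{i,j\}\in\mathcal E_{t'}$ and $l\in\{1,\dots,L\}$ one observes $y^{(l)}_{ij}(t')\in\{0,1\}$ with $\mathbb P(y^{(l)}_{ij}(t')=1)=y^*_{ij}(t')$ (the value 1 means $j$ beats $i$), with $y^{(l)}_{ji}(t')=1-y^{(l)}_{ij}(t')$, all outcomes being independent across unordered pairs, times $t'$ and indices $l$. Put $y_{ij}(t')=\frac1L\sum_{l=1}^L y^{(l)}_{ij}(t')$. Neighborhood and union graph. For $t\in[0,1]$, $\delta\in[\frac12,T]$: $\mathcal N_\delta(t)=\{t'\in\mathcal T: |t-t'|\le \delta/T\}$; $\mathcal N_{ij,\delta}(t)=\{t'\in\mathcal N_\delta(t): \{i,j\}\in\mathcal E_{t'}\}$; $\mathcal E_\delta(t)=\bigcup_{t'\in\mathcal N_\delta(t)}\mathcal E_{t'}$.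 Erdős–Rényi setting. $\mathcal G(n,p)$ is the Erdős–Rényi random graph; the graphs $G_{t'}\sim\mathcal G(n,p(t'))$, $t'\in\mathcal T$, are mutually independent. Put $p_\delta(t)=1-\prod_{t'\in\mathcal N_\delta(t)}(1-p(t'))$. Estimator. With normalization $d_\delta(t)$, define $\hat P(t)\in\mathbb R^{n\times n}$ by $\hat P_{ij}(t)=\frac{1}{d_\delta(t)|\mathcal N_{ij,\delta}(t)|}\sum_{t'\in\mathcal N_{ij,\delta}(t)}y_{ij}(t')$ if $\{i,j\}\in\mathcal E_\delta(t)$, $\hat P_{ij}(t)=0$ for other $i\neq j$, and $\hat P_{ii}(t)=1-\sum_{k\ne i}\hat P_{ik}(t)$. $\hat\pi(t)$ is the stationary distribution (leading left eigenvector, normalized to be a probability vector) of $\hat P(t)$. The target is $\pi^*(t)=w_t^*/\sum_{i=1}^n w^*_{t,i}$, and $b(t)=\max_{i,j\in[n]}w^*_{t,i}/w^*_{t,j}$. Conventions: $a\lesssim c$ (equivalently $c\gtrsim a$) means $a\le Cc$ for an absolute constant $C>0$. Where $\lesssim,\gtrsim$ appear in the hypotheses, the claim is that there exist suitable absolute constants for which the conclusion holds, with an absolute constant in the conclusion. $O(\cdot)$ hides an absolute constant. If $M=0$, quantities with $(2M)^{2/3}$ in the denominator are read as $+\infty$ (so $\delta=T$). *)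

theory Defs
  imports "HOL-Probability.Probability"
begin

text \<open>The probability that \<open>j\<close> beats \<open>i\<close>, not the other way round.\<close>

definition win_prob :: "(real \<Rightarrow> nat \<Rightarrow> real) \<Rightarrow> real \<Rightarrow> nat \<Rightarrow> nat \<Rightarrow> real" where
  "win_prob w t i j = w t j / (w t i + w t j)"

definition pi_star :: "nat \<Rightarrow> (real \<Rightarrow> nat \<Rightarrow> real) \<Rightarrow> real \<Rightarrow> nat \<Rightarrow> real" where
  "pi_star n w t i = w t i / (\<Sum>k\<in>{1..n}. w t k)"

definition cond_number :: "nat \<Rightarrow> (real \<Rightarrow> nat \<Rightarrow> real) \<Rightarrow> real \<Rightarrow> real" where
  "cond_number n w t = Max {w t i / w t j | i j. i \<in> {1..n} \<and> j \<in> {1..n}}"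

definition time_grid :: "nat \<Rightarrow> real set" where
  "time_grid T = (\<lambda>i. real i / real T) ` {0..T}"

text \<open>A graph on \<open>{1..n}\<close> is represented by its set of edges, each edge being a two-element set.\<close>

definition vertex_pairs :: "nat \<Rightarrow> nat set set" where
  "vertex_pairs n = {e. e \<subseteq> {1..n} \<and> card e = 2}"

definition erdos_renyi_pmf :: "nat \<Rightarrow> real \<Rightarrow> nat set set pmf" where
  "erdos_renyi_pmf n q =
     map_pmf (\<lambda>f. {e \<in> vertex_pairs n. f e})
       (Pi_pmf (vertex_pairs n) False (\<lambda>_. bernoulli_pmf q))"

definition graphs_pmf :: "nat \<Rightarrow> nat \<Rightarrow> (real \<Rightarrow> real) \<Rightarrow> (real \<Rightarrow> nat set set) pmf" where
  "graphs_pmf n T p = Pi_pmf (time_grid T) {} (\<lambda>s. erdos_renyi_pmf n (p s))"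

text \<open>
  Given the graphs \<open>G\<close>, there is one independent Bernoulli variable \<open>z (s, i, j, l)\<close> for every time
  \<open>s\<close>, unordered edge \<open>{i, j}\<close> of \<open>G s\<close> (listed with \<open>i < j\<close>) and repetition \<open>l\<close>;
  it is true iff \<open>j\<close> beats \<open>i\<close>. The outcome for the reversed pair is obtained from it in \<open>outcome\<close>.
\<close>

definition observation_index ::
    "nat \<Rightarrow> nat \<Rightarrow> (real \<Rightarrow> nat set set) \<Rightarrow> (real \<times> nat \<times> nat \<times> nat) set" where
  "observation_index T L G =
     {(s, i, j, l). s \<in> time_grid T \<and> i < j \<and> {i, j} \<in> G s \<and> l \<in> {1..L}}"

definition outcomes_pmf ::
    "nat \<Rightarrow> nat \<Rightarrow> (real \<Rightarrow> nat \<Rightarrow> real) \<Rightarrow> (real \<Rightarrow> nat set set)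
      \<Rightarrow> (real \<times> nat \<times> nat \<times> nat \<Rightarrow> bool) pmf" where
  "outcomes_pmf T L w G =
     Pi_pmf (observation_index T L G) False (\<lambda>(s, i, j, l). bernoulli_pmf (win_prob w s i j))"

definition btl_pmf ::
    "nat \<Rightarrow> nat \<Rightarrow> nat \<Rightarrow> (real \<Rightarrow> nat \<Rightarrow> real) \<Rightarrow> (real \<Rightarrow> real)
      \<Rightarrow> ((real \<Rightarrow> nat set set) \<times> (real \<times> nat \<times> nat \<times> nat \<Rightarrow> bool)) pmf" where
  "btl_pmf n T L w p =
     bind_pmf (graphs_pmf n T p) (\<lambda>G. map_pmf (\<lambda>z. (G, z)) (outcomes_pmf T L w G))"

definition outcome ::
    "(real \<times> nat \<times> nat \<times> nat \<Rightarrow> bool) \<Rightarrow> real \<Rightarrow> nat \<Rightarrow> nat \<Rightarrow> nat \<Rightarrow> real" where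
  "outcome z s i j l =
     (if i < j then of_bool (z (s, i, j, l)) else 1 - of_bool (z (s, j, i, l)))"

definition mean_outcome ::
    "nat \<Rightarrow> (real \<times> nat \<times> nat \<times> nat \<Rightarrow> bool) \<Rightarrow> real \<Rightarrow> nat \<Rightarrow> nat \<Rightarrow> real" where
  "mean_outcome L z s i j = 1 / real L * (\<Sum>l\<in>{1..L}. outcome z s i j l)"

definition nbhd :: "nat \<Rightarrow> real \<Rightarrow> real \<Rightarrow> real set" where
  "nbhd T \<delta> t = {s \<in> time_grid T. \<bar>t - s\<bar> \<le> \<delta> / real T}"

definition edge_nbhd ::
    "nat \<Rightarrow> (real \<Rightarrow> nat set set) \<Rightarrow> real \<Rightarrow> real \<Rightarrow> nat \<Rightarrow> nat \<Rightarrow> real set" where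
  "edge_nbhd T G \<delta> t i j = {s \<in> nbhd T \<delta> t. {i, j} \<in> G s}"

definition union_edges :: "nat \<Rightarrow> (real \<Rightarrow> nat set set) \<Rightarrow> real \<Rightarrow> real \<Rightarrow> nat set set" where
  "union_edges T G \<delta> t = (\<Union>s\<in>nbhd T \<delta> t. G s)"

definition union_prob :: "nat \<Rightarrow> (real \<Rightarrow> real) \<Rightarrow> real \<Rightarrow> real \<Rightarrow> real" where
  "union_prob T p \<delta> t = 1 - (\<Prod>s\<in>nbhd T \<delta> t. 1 - p s)"

definition P_hat_offdiag ::
    "nat \<Rightarrow> nat \<Rightarrow> real \<Rightarrow> real \<Rightarrow> real \<Rightarrow> (real \<Rightarrow> nat set set)
      \<Rightarrow> (real \<times> nat \<times> nat \<times> nat \<Rightarrow> bool) \<Rightarrow> nat \<Rightarrow> nat \<Rightarrow> real" where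
  "P_hat_offdiag T L d \<delta> t G z i j =
     (if {i, j} \<in> union_edges T G \<delta> t
      then 1 / (d * real (card (edge_nbhd T G \<delta> t i j)))
             * (\<Sum>s\<in>edge_nbhd T G \<delta> t i j. mean_outcome L z s i j)
      else 0)"

definition P_hat ::
    "nat \<Rightarrow> nat \<Rightarrow> nat \<Rightarrow> real \<Rightarrow> real \<Rightarrow> real \<Rightarrow> (real \<Rightarrow> nat set set)
      \<Rightarrow> (real \<times> nat \<times> nat \<times> nat \<Rightarrow> bool) \<Rightarrow> nat \<Rightarrow> nat \<Rightarrow> real" where
  "P_hat n T L d \<delta> t G z i j =
     (if i = j then 1 - (\<Sum>k\<in>{1..n} - {i}. P_hat_offdiag T L d \<delta> t G z i k)
      else P_hat_offdiag T L d \<delta> t G z i j)"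

definition transition_matrix :: "nat \<Rightarrow> (nat \<Rightarrow> nat \<Rightarrow> real) \<Rightarrow> bool" where
  "transition_matrix n P \<longleftrightarrow>
     (\<forall>i\<in>{1..n}. (\<forall>j\<in>{1..n}. 0 \<le> P i j) \<and> (\<Sum>j\<in>{1..n}. P i j) = 1)"

text \<open>
  Stationarity is only considered for transition matrices, whose spectral radius is 1, so that a
  left eigenvector for the eigenvalue 1 is a leading one. Vectors are extended by 0 outside
  \<open>{1..n}\<close> in order that uniqueness makes sense.
\<close>

definition stationary_distribution ::
    "nat \<Rightarrow> (nat \<Rightarrow> nat \<Rightarrow> real) \<Rightarrow> (nat \<Rightarrow> real) \<Rightarrow> bool" where
  "stationary_distribution n P v \<longleftrightarrow>
     transition_matrix n P \<and>
     (\<forall>i\<in>{1..n}. 0 \<le> v i) \<and> (\<Sum>i\<in>{1..n}. v i) = 1 \<and> (\<forall>i. i \<notin> {1..n} \<longrightarrow> v i = 0) \<and>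
     (\<forall>j\<in>{1..n}. (\<Sum>i\<in>{1..n}. v i * P i j) = v j)"

definition the_stationary_distribution :: "nat \<Rightarrow> (nat \<Rightarrow> nat \<Rightarrow> real) \<Rightarrow> nat \<Rightarrow> real" where
  "the_stationary_distribution n P = (THE v. stationary_distribution n P v)"

text \<open>
  The case distinction on \<open>M = 0\<close> implements the convention that a quotient with
  \<open>(2 * M) powr (2/3)\<close> in the denominator is then infinite (in HOL it would be 0).
\<close>

definition bandwidth :: "nat \<Rightarrow> nat \<Rightarrow> nat \<Rightarrow> real \<Rightarrow> real \<Rightarrow> real \<Rightarrow> real" where
  "bandwidth n T L M b pmin =
     (if M = 0 then real T
      else min (b powr (2/3) / ((2 * M) powr (2/3) * real n * (real L * pmin) powr (1/3))
                  * real T powr (2/3))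
               (real T))"

definition bias_rate :: "nat \<Rightarrow> nat \<Rightarrow> nat \<Rightarrow> real \<Rightarrow> real \<Rightarrow> real \<Rightarrow> real" where
  "bias_rate n T L M b pmin =
     (if M = 0 then 1
      else min (b powr (2/3) /
                  ((2 * M) powr (2/3) * real n * (real L * pmin) powr (1/3) * real T powr (1/3)))
               1)"

definition noise_rate :: "nat \<Rightarrow> nat \<Rightarrow> nat \<Rightarrow> real \<Rightarrow> real \<Rightarrow> real \<Rightarrow> real" where
  "noise_rate n T L M b pmin =
     max ((2 * M) powr (1/3) * real n powr (1/2) * (real L * pmin) powr (1/6) /
            (b powr (1/3) * real T powr (1/3)))
         (1 / sqrt (real T))"

end

theory Submission
  imports Defs
begin

text \<open>
  Since \<open>\<delta> p\<^sub>m\<^sub>i\<^sub>n\<close> is at least a large multiple of \<open>log n\<close>, with high probability every pair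
  is compared at a constant fraction of the expected number of times, so the union graph is
  complete and the estimated matrix is a perturbation of the reversible chain with rates
  \<open>\<pi>\<^sub>j / (d (\<pi>\<^sub>i + \<pi>\<^sub>j))\<close>, whose spectral gap is of order \<open>1 / b\<close>. The perturbation is
  skew-symmetric off the diagonal. Testing the balance equations of the difference \<open>h\<close> of the
  stationary vectors with \<open>h / \<pi>\<close> bounds \<open>h\<close> through the spectral gap as soon as the operator norm
  and the row sums of the perturbation are small. For the sampling noise, a lattice net and
  Hoeffding's inequality bound the operator norm without a logarithmic factor, and a union bound
  controls the row sums.
\<close>

section \<open>Operator norms from a lattice net\<close>

text \<open>Two features of the claim shape the argument. The rate carries no \<open>ln n\<close>,
  although a union bound over the row sums of the noise costs a factor \<open>sqrt (ln n)\<close>.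
  Uniform row sums are therefore used only in the smallness condition, whose hypothesis contains
  that factor. In the source term of the perturbed balance equations the row sums enter only through
  their L2 norm, and there the operator norm applied to the vector of ones is enough. The other
  obstacle is the diagonal of the estimated matrix, which depends on all other entries of its row.
  Written as net flows between pairs of states, the balance equations do not contain the diagonal.
  The two outcomes of a comparison add up to 1, so an error \<open>A i j\<close> in one direction is
  \<open>- A i j\<close> in the other, and the net flow from i to j changes by
  \<open>(v i + v j) * A i j\<close>. The same skew-symmetry merges the entries (i, j) and (j, i)
  into one independent quantity, to which Hoeffding's inequality applies. The graphs are held fixed
  in this step, and the bias from averaging over nearby times is bounded deterministically.\<close>

definition lattice_points :: "'a set \<Rightarrow> ('a \<Rightarrow> int) set" where
  "lattice_points V = {z \<in> V \<rightarrow>\<^sub>E UNIV. (\<Sum>i\<in>V. (z i)\<^sup>2) \<le> 16 * int (card V)}"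

text \<open>
  The net has mesh \<open>1 / (4 sqrt n)\<close>, so that rounding moves a vector by at most \<open>1/4\<close> in norm and the net
  determines the operator norm up to a factor 2.
\<close>

definition net_vector :: "'a set \<Rightarrow> ('a \<Rightarrow> int) \<Rightarrow> 'a \<Rightarrow> real" where
  "net_vector V z i = of_int (z i) / (4 * sqrt (card V))"

definition bilinear_form :: "'a set \<Rightarrow> ('a \<Rightarrow> 'a \<Rightarrow> real) \<Rightarrow> ('a \<Rightarrow> real) \<Rightarrow> ('a \<Rightarrow> real) \<Rightarrow> real" where
  "bilinear_form V A u v = (\<Sum>i\<in>V. \<Sum>j\<in>V. u i * A i j * v j)"

lemma L2_set_power2: "(L2_set f V)\<^sup>2 = (\<Sum>i\<in>V. (f i)\<^sup>2)"
  by (simp add: L2_set_def sum_nonneg)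

lemma abs_le_square_int: "\<bar>z\<bar> \<le> z\<^sup>2" for z :: int
proof (cases "z = 0")
  case False
  then have "\<bar>z\<bar> * 1 \<le> \<bar>z\<bar> * \<bar>z\<bar>" by (intro mult_left_mono) auto
  then show ?thesis by (simp add: power2_eq_square flip: abs_mult)
qed simp

lemma lattice_points_abs_le:
  assumes "finite V" "z \<in> lattice_points V" "i \<in> V"
  shows "\<bar>z i\<bar> \<le> 16 * int (card V)"
proof -
  have "\<bar>z i\<bar> \<le> (z i)\<^sup>2" by (simp add: abs_le_square_int)
  also have "\<dots> \<le> (\<Sum>i\<in>V. (z i)\<^sup>2)" using assms by (intro member_le_sum) auto
  also have "\<dots> \<le> 16 * int (card V)" using assms by (simp add: lattice_points_def)
  finally show ?thesis .
qed

lemma lattice_points_subset: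
  "finite V \<Longrightarrow> lattice_points V \<subseteq> V \<rightarrow>\<^sub>E {- int (16 * card V)..int (16 * card V)}"
proof (intro subsetI PiE_I)
  fix z i assume V: "finite V" and z: "z \<in> lattice_points V"
  show "z i \<in> {- int (16 * card V)..int (16 * card V)}" if "i \<in> V"
    using lattice_points_abs_le[OF V z that] by auto
  show "z i = undefined" if "i \<notin> V"
    using z that by (auto simp: lattice_points_def)
qed

lemma finite_lattice_points: "finite V \<Longrightarrow> finite (lattice_points V)"
  by (rule finite_subset[OF lattice_points_subset]) (auto intro: finite_PiE)

text \<open>Two-sided geometric series: each coordinate contributes at most 3 to the count of
  lattice points. The exact value is what makes the induction close.\<close>

lemma sum_half_power_abs: "(\<Sum>k\<in>{- int K..int K}. (1/2 :: real) ^ nat \<bar>k\<bar>) = 3 - 2 * (1/2) ^ K"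
proof (induction K)
  case (Suc K)
  have S: "{- int (Suc K)..int (Suc K)} = {- int (Suc K), int (Suc K)} \<union> {- int K..int K}"
    by auto
  have "(\<Sum>k\<in>{- int (Suc K)..int (Suc K)}. (1/2 :: real) ^ nat \<bar>k\<bar>) =
      (\<Sum>k\<in>{- int (Suc K), int (Suc K)}. (1/2) ^ nat \<bar>k\<bar>) + (3 - 2 * (1/2) ^ K)"
    unfolding S Suc.IH[symmetric] by (intro sum.union_disjoint) auto
  also have "(\<Sum>k\<in>{- int (Suc K), int (Suc K)}. (1/2 :: real) ^ nat \<bar>k\<bar>) = 2 * (1/2) ^ Suc K"
    by (subst sum.insert) (auto simp del: of_nat_Suc)
  finally show ?case by simp
qed simp

text \<open>Exponential weights: since |z| <= z^2 for integers, a lattice point has l1-norm at most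
  K = 16 n, so the weight 2^K * (1/2)^(l1-norm) is at least 1 there. Summed over the whole box, this
  weight factorizes into n geometric series. The count is exponential in n, whereas the box alone
  would give a power of order n^n and a logarithm in the operator norm.\<close>

lemma card_lattice_points:
  assumes "finite V"
  shows "real (card (lattice_points V)) \<le> (3 * 2 ^ 16) ^ card V"
proof -
  define n where "n = card V"
  define K where "K = 16 * n"
  have "real (card (lattice_points V)) = (\<Sum>z\<in>lattice_points V. 1)" by simp
  also have "\<dots> \<le> (\<Sum>z\<in>lattice_points V. 2 ^ K * (\<Prod>i\<in>V. (1/2) ^ nat \<bar>z i\<bar>))"
  proof (intro sum_mono)
    fix z assume z: "z \<in> lattice_points V"
    have "int (\<Sum>i\<in>V. nat \<bar>z i\<bar>) \<le> (\<Sum>i\<in>V. (z i)\<^sup>2)"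
      unfolding of_nat_sum
    proof (intro sum_mono)
      fix i show "int (nat \<bar>z i\<bar>) \<le> (z i)\<^sup>2" by (simp add: abs_le_square_int)
    qed
    also have "\<dots> \<le> int K" using z by (simp add: lattice_points_def K_def n_def)
    finally have le: "(\<Sum>i\<in>V. nat \<bar>z i\<bar>) \<le> K" by linarith
    have "(1 :: real) = 2 ^ K * (1/2) ^ K" by (simp add: power_one_over)
    also have "\<dots> \<le> 2 ^ K * (1/2) ^ (\<Sum>i\<in>V. nat \<bar>z i\<bar>)"
      using le by (intro mult_left_mono power_decreasing) auto
    finally show "(1 :: real) \<le> 2 ^ K * (\<Prod>i\<in>V. (1/2) ^ nat \<bar>z i\<bar>)" by (simp add: power_sum)
  qed
  also have "\<dots> \<le> (\<Sum>z\<in>V \<rightarrow>\<^sub>E {- int K..int K}. 2 ^ K * (\<Prod>i\<in>V. (1/2) ^ nat \<bar>z i\<bar>))"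
    using assms lattice_points_subset[OF assms]
    by (intro sum_mono2) (auto intro!: finite_PiE mult_nonneg_nonneg prod_nonneg simp: K_def n_def)
  also have "\<dots> = 2 ^ K * (\<Prod>i\<in>V. \<Sum>k\<in>{- int K..int K}. (1/2) ^ nat \<bar>k\<bar>)"
    using assms by (subst prod_sum_PiE) (auto simp: sum_distrib_left)
  also have "\<dots> \<le> 2 ^ K * (\<Prod>i\<in>V. 3)"
    by (intro mult_left_mono prod_mono conjI sum_nonneg) (auto simp: sum_half_power_abs)
  also have "\<dots> = (3 * 2 ^ 16) ^ card V"
    by (simp add: K_def n_def power_mult flip: power_mult_distrib)
  finally show ?thesis .
qed

lemma lattice_approx:
  assumes V: "finite V" "V \<noteq> {}" and u: "L2_set u V \<le> 1"
  obtains z where "z \<in> lattice_points V" "L2_set (net_vector V z) V \<le> 1"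
    "L2_set (\<lambda>i. u i - net_vector V z i) V \<le> 1/4"
proof -
  define s where "s = 4 * sqrt (card V)"
  have s0: "s > 0" using V by (simp add: s_def card_gt_0_iff)
  have s2: "s\<^sup>2 = 16 * card V" by (simp add: s_def power_mult_distrib)
  \<comment> \<open>Rounding towards zero increases no coordinate in absolute value, so the rounded
    vector stays in the unit ball and hence in the net.\<close>
  define z where "z = (\<lambda>i\<in>V. if u i \<ge> 0 then \<lfloor>s * u i\<rfloor> else - \<lfloor>- (s * u i)\<rfloor>)"
  have za: "\<bar>of_int (z i)\<bar> \<le> \<bar>s * u i\<bar>" and zb: "\<bar>s * u i - of_int (z i)\<bar> \<le> 1" if "i \<in> V" for i
  proof -
    have "s * u i \<ge> 0 \<longleftrightarrow> u i \<ge> 0" using s0 by (simp add: zero_le_mult_iff)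
    then show "\<bar>of_int (z i)\<bar> \<le> \<bar>s * u i\<bar>" "\<bar>s * u i - of_int (z i)\<bar> \<le> 1"
      using that unfolding z_def by (auto; linarith)+
  qed
  have net: "net_vector V z i = of_int (z i) / s" for i by (simp add: net_vector_def s_def)
  have u2: "(\<Sum>i\<in>V. (u i)\<^sup>2) \<le> 1"
    using u L2_set_power2[of u V] by (metis L2_set_nonneg power_le_one)
  have zu: "(of_int (z i))\<^sup>2 \<le> s\<^sup>2 * (u i)\<^sup>2" if "i \<in> V" for i
    using za[OF that] by (metis abs_le_square_iff power_mult_distrib)
  have "real_of_int (\<Sum>i\<in>V. (z i)\<^sup>2) \<le> (\<Sum>i\<in>V. s\<^sup>2 * (u i)\<^sup>2)"
    unfolding of_int_sum by (intro sum_mono) (use zu in auto)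
  also have "\<dots> \<le> s\<^sup>2" using u2 by (simp flip: sum_distrib_left add: mult_left_le)
  finally have zs: "real_of_int (\<Sum>i\<in>V. (z i)\<^sup>2) \<le> s\<^sup>2" .
  have zl: "z \<in> lattice_points V"
    using zs unfolding s2 lattice_points_def by (auto simp: z_def simp flip: of_int_le_iff[where 'a=real])
  have "(L2_set (net_vector V z) V)\<^sup>2 = real_of_int (\<Sum>i\<in>V. (z i)\<^sup>2) / s\<^sup>2"
    by (simp add: L2_set_power2 net power_divide sum_divide_distrib)
  also have "\<dots> \<le> 1" using zs s0 by (simp add: divide_simps)
  finally have "(L2_set (net_vector V z) V)\<^sup>2 \<le> 1\<^sup>2" by simp
  then have A: "L2_set (net_vector V z) V \<le> 1" by (rule power2_le_imp_le) simp
  have "(L2_set (\<lambda>i. u i - net_vector V z i) V)\<^sup>2 = (\<Sum>i\<in>V. (s * u i - of_int (z i))\<^sup>2) / s\<^sup>2"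
    unfolding L2_set_power2 sum_divide_distrib
  proof (intro sum.cong refl)
    fix i
    have "u i - net_vector V z i = (s * u i - of_int (z i)) / s" using s0 by (simp add: net diff_divide_distrib)
    then show "(u i - net_vector V z i)\<^sup>2 = (s * u i - of_int (z i))\<^sup>2 / s\<^sup>2" by (simp add: power_divide)
  qed
  also have "\<dots> \<le> (\<Sum>i\<in>V. 1) / s\<^sup>2"
    by (intro divide_right_mono sum_mono) (use zb in \<open>auto simp: abs_square_le_1\<close>)
  also have "\<dots> = (1/4)\<^sup>2" using V unfolding s2 by (simp add: power2_eq_square card_gt_0_iff)
  finally have B: "L2_set (\<lambda>i. u i - net_vector V z i) V \<le> 1/4"
    by (rule power2_le_imp_le) simp
  show thesis by (rule that[OF zl A B])
qed

lemma bilinear_form_scale: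
  "bilinear_form V A (\<lambda>i. c * u i) (\<lambda>i. d * v i) = c * d * bilinear_form V A u v"
  by (simp add: bilinear_form_def sum_distrib_left mult_ac)

lemma bilinear_form_diff_left:
  "bilinear_form V A (\<lambda>i. u i - u' i) v = bilinear_form V A u v - bilinear_form V A u' v"
  by (simp add: bilinear_form_def sum_subtractf algebra_simps)

lemma bilinear_form_diff_right:
  "bilinear_form V A u (\<lambda>i. v i - v' i) = bilinear_form V A u v - bilinear_form V A u v'"
  by (simp add: bilinear_form_def sum_subtractf algebra_simps)

text \<open>Let S be the supremum of the form over the unit balls. Replacing both vectors by net
  points leaves two remainders of at most S / 4 each, so S <= x + S / 2.\<close>

lemma bilinear_form_le_from_net:
  assumes V: "finite V"
    and net: "\<And>y z. y \<in> lattice_points V \<Longrightarrow> z \<in> lattice_points V \<Longrightarrow>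
                bilinear_form V A (net_vector V y) (net_vector V z) \<le> x"
  shows "bilinear_form V A u v \<le> 2 * x * (L2_set u V * L2_set v V)"
proof (cases "L2_set u V = 0 \<or> L2_set v V = 0")
  case True
  then have "bilinear_form V A u v = 0"
    using V by (auto simp: bilinear_form_def L2_set_eq_0_iff intro!: sum.neutral)
  then show ?thesis using True by auto
next
  case False
  then have ne: "V \<noteq> {}" by auto
  define S where "S = {bilinear_form V A u v | u v. L2_set u V \<le> 1 \<and> L2_set v V \<le> 1}"
  \<comment> \<open>The supremum has to be finite, otherwise bounding it by half of itself would say
    nothing.\<close>
  have "y \<le> (\<Sum>i\<in>V. \<Sum>j\<in>V. \<bar>A i j\<bar>)" if "y \<in> S" for y
  proof -
    from that obtain u v where y: "y = bilinear_form V A u v" and u: "L2_set u V \<le> 1" and v: "L2_set v V \<le> 1"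
      by (auto simp: S_def)
    have le1: "\<bar>f i\<bar> \<le> 1" if "L2_set f V \<le> 1" "i \<in> V" for f :: "'a \<Rightarrow> real" and i
    proof -
      have "\<bar>f i\<bar> \<le> L2_set (\<lambda>i. \<bar>f i\<bar>) V" by (rule member_le_L2_set[OF V that(2)])
      also have "\<dots> = L2_set f V" by (simp add: L2_set_def)
      finally show ?thesis using that by simp
    qed
    have "u i * A i j * v j \<le> \<bar>A i j\<bar>" if "i \<in> V" "j \<in> V" for i j
    proof -
      have "u i * A i j * v j \<le> \<bar>u i\<bar> * \<bar>A i j\<bar> * \<bar>v j\<bar>" by (metis abs_ge_self abs_mult)
      also have "\<dots> \<le> 1 * \<bar>A i j\<bar> * 1" using le1[OF u that(1)] le1[OF v that(2)] by (intro mult_mono) auto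
      finally show ?thesis by simp
    qed
    then show ?thesis unfolding y bilinear_form_def by (intro sum_mono) auto
  qed
  then have bdd: "bdd_above S" by (auto simp: bdd_above_def)
  have ne': "S \<noteq> {}" unfolding S_def by (auto intro!: exI[of _ "\<lambda>_. 0"] simp: L2_set_def)
  have up: "bilinear_form V A u v \<le> Sup S" if "L2_set u V \<le> 1" "L2_set v V \<le> 1" for u v
    using that by (intro cSup_upper bdd) (auto simp: S_def)
  have scal: "L2_set (\<lambda>i. c * f i) V = \<bar>c\<bar> * L2_set f V" for c :: real and f
    by (simp add: L2_set_def power_mult_distrib real_sqrt_mult flip: sum_distrib_left)
  have "Sup S \<le> x + Sup S / 2"
  proof (rule cSup_least[OF ne'])
    fix y assume "y \<in> S"
    then obtain u v where y: "y = bilinear_form V A u v" and u: "L2_set u V \<le> 1" and v: "L2_set v V \<le> 1"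
      by (auto simp: S_def)
    obtain a where a: "a \<in> lattice_points V" "L2_set (net_vector V a) V \<le> 1"
      "L2_set (\<lambda>i. u i - net_vector V a i) V \<le> 1/4" by (rule lattice_approx[OF V ne u])
    obtain b where b: "b \<in> lattice_points V" "L2_set (net_vector V b) V \<le> 1"
      "L2_set (\<lambda>i. v i - net_vector V b i) V \<le> 1/4" by (rule lattice_approx[OF V ne v])
    have "L2_set (\<lambda>i. 4 * (u i - net_vector V a i)) V \<le> 1" unfolding scal using a(3) by simp
    from up[OF this v] have 1: "4 * bilinear_form V A (\<lambda>i. u i - net_vector V a i) v \<le> Sup S"
      using bilinear_form_scale[of V A 4 "\<lambda>i. u i - net_vector V a i" 1 v] by simp
    have "L2_set (\<lambda>i. 4 * (v i - net_vector V b i)) V \<le> 1" unfolding scal using b(3) by simp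
    from up[OF a(2) this] have 2: "4 * bilinear_form V A (net_vector V a) (\<lambda>i. v i - net_vector V b i) \<le> Sup S"
      using bilinear_form_scale[of V A 1 "net_vector V a" 4 "\<lambda>i. v i - net_vector V b i"] by simp
    have "y = bilinear_form V A (\<lambda>i. u i - net_vector V a i) v
       + bilinear_form V A (net_vector V a) (\<lambda>i. v i - net_vector V b i)
       + bilinear_form V A (net_vector V a) (net_vector V b)"
      by (simp add: y bilinear_form_diff_left bilinear_form_diff_right)
    with 1 2 net[OF a(1) b(1)] show "y \<le> x + Sup S / 2" by linarith
  qed
  then have S2: "Sup S \<le> 2 * x" by simp
  define p q where "p = L2_set u V" and "q = L2_set v V"
  have pq: "p > 0" "q > 0" using False L2_set_nonneg[of u V] L2_set_nonneg[of v V] by (auto simp: p_def q_def less_le)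
  have "bilinear_form V A (\<lambda>i. (1/p) * u i) (\<lambda>i. (1/q) * v i) \<le> Sup S"
    using pq by (intro up) (simp_all only: scal, simp_all add: p_def q_def)
  then have "bilinear_form V A u v / (p * q) \<le> 2 * x" using S2 unfolding bilinear_form_scale by simp
  then show ?thesis using pq by (simp add: divide_le_eq p_def q_def)
qed

section \<open>Perturbation of the balance equations\<close>

lemma L2_set_le_sqrt: "(\<Sum>i\<in>V. (f i)\<^sup>2) \<le> x \<Longrightarrow> L2_set f V \<le> sqrt x"
  by (simp add: L2_set_def)

lemma sum_mult_le_L2_set: "(\<Sum>i\<in>V. f i * g i) \<le> L2_set f V * L2_set g V"
proof -
  have "(\<Sum>i\<in>V. f i * g i) \<le> (\<Sum>i\<in>V. \<bar>f i\<bar> * \<bar>g i\<bar>)"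
    by (intro sum_mono) (metis abs_ge_self abs_mult)
  also have "\<dots> \<le> L2_set f V * L2_set g V" by (rule L2_set_mult_ineq)
  finally show ?thesis .
qed

text \<open>Exchanging i and j, under which q is invariant, and averaging turns
  \<open>(f i - f j) * f j\<close> into minus half the square of \<open>f i - f j\<close>.\<close>

lemma dirichlet_form_eq:
  fixes q :: "'a \<Rightarrow> 'a \<Rightarrow> real"
  assumes "\<And>i j. q i j = q j i"
  shows "(\<Sum>j\<in>V. f j * (\<Sum>i\<in>V. q i j * (f i - f j))) = - (\<Sum>i\<in>V. \<Sum>j\<in>V. q i j * (f i - f j)\<^sup>2) / 2"
proof -
  have 1: "(\<Sum>j\<in>V. f j * (\<Sum>i\<in>V. q i j * (f i - f j))) = (\<Sum>i\<in>V. \<Sum>j\<in>V. q i j * (f i - f j) * f j)"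
    by (subst sum.swap) (simp add: sum_distrib_left mult_ac)
  have 2: "(\<Sum>j\<in>V. f j * (\<Sum>i\<in>V. q i j * (f i - f j))) = (\<Sum>i\<in>V. \<Sum>j\<in>V. q i j * (f j - f i) * f i)"
    by (simp add: sum_distrib_left assms mult_ac)
  have "2 * (\<Sum>j\<in>V. f j * (\<Sum>i\<in>V. q i j * (f i - f j)))
     = (\<Sum>i\<in>V. \<Sum>j\<in>V. q i j * (f i - f j) * f j) + (\<Sum>i\<in>V. \<Sum>j\<in>V. q i j * (f j - f i) * f i)"
    using 1 2 by linarith
  also have "\<dots> = (\<Sum>i\<in>V. \<Sum>j\<in>V. - (q i j * (f i - f j)\<^sup>2))"
    unfolding sum.distrib[symmetric] by (intro sum.cong refl) (simp add: power2_eq_square algebra_simps)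
  finally have "2 * (\<Sum>j\<in>V. f j * (\<Sum>i\<in>V. q i j * (f i - f j)))
     = (\<Sum>i\<in>V. \<Sum>j\<in>V. - (q i j * (f i - f j)\<^sup>2))" .
  then show ?thesis by (simp add: sum_negf)
qed

text \<open>The variance as half the mean squared difference of two independent copies, for f of
  mean 0 under \<pi>.\<close>

lemma sum_weighted_square_differences:
  fixes \<pi> f :: "'a \<Rightarrow> real"
  assumes "sum \<pi> V = 1" "(\<Sum>i\<in>V. \<pi> i * f i) = 0"
  shows "(\<Sum>i\<in>V. \<Sum>j\<in>V. \<pi> i * \<pi> j * (f i - f j)\<^sup>2) = 2 * (\<Sum>i\<in>V. \<pi> i * (f i)\<^sup>2)"
proof -
  have "(\<Sum>i\<in>V. \<Sum>j\<in>V. \<pi> i * \<pi> j * (f i - f j)\<^sup>2) =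
      (\<Sum>i\<in>V. \<Sum>j\<in>V. (\<pi> i * (f i)\<^sup>2) * \<pi> j + \<pi> i * (\<pi> j * (f j)\<^sup>2) - 2 * ((\<pi> i * f i) * (\<pi> j * f j)))"
    by (intro sum.cong refl) (simp add: power2_eq_square algebra_simps)
  also have "\<dots> = (\<Sum>i\<in>V. \<pi> i * (f i)\<^sup>2) * sum \<pi> V + sum \<pi> V * (\<Sum>i\<in>V. \<pi> i * (f i)\<^sup>2)
      - 2 * ((\<Sum>i\<in>V. \<pi> i * f i) * (\<Sum>i\<in>V. \<pi> i * f i))"
    by (simp only: sum.distrib sum_subtractf sum_distrib_left[symmetric] sum_distrib_right[symmetric])
  finally show ?thesis using assms by simp
qed

text \<open>Spectral gap by comparison: as \<open>\<pi> i + \<pi> j \<le> 2 * hi\<close>, the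
  conductances dominate a multiple of \<open>\<pi> i * \<pi> j\<close>, for which the Dirichlet form
  is a multiple of the variance. The comparison is direct because every pair of states is
  joined.\<close>

lemma dirichlet_form_ge:
  fixes \<pi> f :: "'a \<Rightarrow> real"
  assumes \<pi>: "\<And>i. i \<in> V \<Longrightarrow> 0 < \<pi> i" "\<And>i. i \<in> V \<Longrightarrow> \<pi> i \<le> hi" and d: "d > 0" "hi > 0"
    and "sum \<pi> V = 1" "(\<Sum>i\<in>V. \<pi> i * f i) = 0"
  shows "(\<Sum>i\<in>V. \<pi> i * (f i)\<^sup>2) / (d * hi)
    \<le> (\<Sum>i\<in>V. \<Sum>j\<in>V. \<pi> i * \<pi> j / (d * (\<pi> i + \<pi> j)) * (f i - f j)\<^sup>2)"
proof -
  have "(\<Sum>i\<in>V. \<pi> i * (f i)\<^sup>2) / (d * hi) = (\<Sum>i\<in>V. \<Sum>j\<in>V. \<pi> i * \<pi> j / (d * (2 * hi)) * (f i - f j)\<^sup>2)"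
    using sum_weighted_square_differences[OF assms(5,6)] d
    by (simp add: sum_divide_distrib[symmetric] field_simps)
  also have "\<dots> \<le> (\<Sum>i\<in>V. \<Sum>j\<in>V. \<pi> i * \<pi> j / (d * (\<pi> i + \<pi> j)) * (f i - f j)\<^sup>2)"
  proof (intro sum_mono mult_right_mono divide_left_mono mult_left_mono)
    fix i j assume ij: "i \<in> V" "j \<in> V"
    show "\<pi> i + \<pi> j \<le> 2 * hi" using \<pi>(2)[OF ij(1)] \<pi>(2)[OF ij(2)] by simp
    show "0 \<le> \<pi> i * \<pi> j" using \<pi>(1)[OF ij(1)] \<pi>(1)[OF ij(2)] by simp
    show "0 < d * (2 * hi) * (d * (\<pi> i + \<pi> j))" using \<pi>(1)[OF ij(1)] \<pi>(1)[OF ij(2)] d by simp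
  qed (use d in auto)
  finally show ?thesis .
qed

text \<open>Energy estimate with test function \<open>f = h / \<pi>\<close>. With X the squared norm
  of f in L2 of \<pi>, the Dirichlet form yields at least X / (6 b), the perturbation costs at most
  \<open>(a * sqrt b + \<rho>) * X\<close>, and the smallness condition lets half of the gap absorb
  this; only the source g is left. The factor \<open>sqrt b\<close> arises since h and f are
  compared to X with the constants hi and 1 / lo.\<close>

lemma balance_perturbation:
  fixes \<pi> h g :: "'a \<Rightarrow> real" and lo hi b d a \<rho> :: real
  assumes V: "finite V" "V \<noteq> {}"
    and \<pi>: "\<And>i. i \<in> V \<Longrightarrow> lo \<le> \<pi> i" "\<And>i. i \<in> V \<Longrightarrow> \<pi> i \<le> hi" "sum \<pi> V = 1"
    and lo: "0 < lo" "hi \<le> b * lo" and b: "b \<ge> 1" and d: "0 < d" "d \<le> 3 * card V"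
    and A: "\<And>u v. bilinear_form V A u v \<le> a * (L2_set u V * L2_set v V)"
    and rows: "\<And>j. j \<in> V \<Longrightarrow> \<bar>\<Sum>i\<in>V. A i j\<bar> \<le> \<rho>"
    and a: "a \<ge> 0" and small: "a * sqrt b + \<rho> \<le> 1 / (12 * b)"
    and h: "sum h V = 0"
    and balance: "\<And>j. j \<in> V \<Longrightarrow>
       (\<Sum>i\<in>V. \<pi> i * \<pi> j / (d * (\<pi> i + \<pi> j)) * (h i / \<pi> i - h j / \<pi> j))
         + (\<Sum>i\<in>V. (h i + h j) * A i j) + g j = 0"
  shows "L2_set h V \<le> 12 * b * sqrt b * L2_set g V"
proof -
  have \<pi>0: "0 < \<pi> i" if "i \<in> V" for i using \<pi>(1)[OF that] lo by simp
  have hi: "hi > 0" using V \<pi>0 \<pi>(2) by fastforce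
  define f where "f i = h i / \<pi> i" for i
  have hf: "h i = \<pi> i * f i" if "i \<in> V" for i using \<pi>0[OF that] by (simp add: f_def)
  define q where "q i j = \<pi> i * \<pi> j / (d * (\<pi> i + \<pi> j))" for i j
  define X where "X = (\<Sum>i\<in>V. \<pi> i * (f i)\<^sup>2)"
  define D where "D = (\<Sum>i\<in>V. \<Sum>j\<in>V. q i j * (f i - f j)\<^sup>2)"
  define G where "G = L2_set g V"
  have X0: "X \<ge> 0" unfolding X_def by (intro sum_nonneg mult_nonneg_nonneg) (use \<pi>0 in \<open>auto intro: less_imp_le\<close>)
  have G0: "G \<ge> 0" by (simp add: G_def)
  have hfs: "(\<Sum>i\<in>V. \<pi> i * f i) = 0" using h hf by simp
  have "card V * lo \<le> sum \<pi> V" using sum_mono[of V "\<lambda>_. lo" \<pi>] \<pi>(1) by simp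
  then have nlo: "card V * lo \<le> 1" using \<pi>(3) by simp
  \<comment> \<open>Since \<pi> sums to 1, \<open>card V * lo \<le> 1\<close>; with d of order n
    this makes the gap of order 1 / b, independently of n.\<close>
  have dh: "d * hi \<le> 3 * b"
  proof -
    have "d * hi \<le> (3 * card V) * (b * lo)" using d lo hi b by (intro mult_mono) auto
    also have "\<dots> = 3 * b * (card V * lo)" by simp
    also have "\<dots> \<le> 3 * b * 1" using nlo b by (intro mult_left_mono) auto
    finally show ?thesis by simp
  qed
  have "X / (3 * b) \<le> X / (d * hi)" using dh d hi X0 b by (intro divide_left_mono) auto
  also have "\<dots> \<le> D"
    unfolding X_def D_def q_def by (rule dirichlet_form_ge) (use \<pi>0 \<pi>(2,3) d hi hfs in auto)
  finally have gap: "X / (6 * b) \<le> D / 2" using b by (simp add: field_simps)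
  have "0 = (\<Sum>j\<in>V. f j * ((\<Sum>i\<in>V. q i j * (f i - f j)) + (\<Sum>i\<in>V. (h i + h j) * A i j) + g j))"
    using balance unfolding q_def f_def by simp
  also have "\<dots> = - D / 2 + (\<Sum>j\<in>V. f j * (\<Sum>i\<in>V. (h i + h j) * A i j)) + (\<Sum>j\<in>V. f j * g j)"
    using dirichlet_form_eq[of q f V] by (simp add: q_def D_def mult.commute add.commute distrib_left sum.distrib)
  \<comment> \<open>The two summands behave differently: \<open>h i\<close> produces a bilinear form
    in h and f, while \<open>h j\<close> leaves a column sum of A with weight
    \<open>f j * h j = \<pi> j * (f j)\<^sup>2\<close>.\<close>
  also have "(\<Sum>j\<in>V. f j * (\<Sum>i\<in>V. (h i + h j) * A i j)) =
      bilinear_form V A h f + (\<Sum>j\<in>V. f j * h j * (\<Sum>i\<in>V. A i j))"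
    unfolding bilinear_form_def sum.swap[of "\<lambda>i j. h i * A i j * f j" V V]
    by (simp add: sum_distrib_left sum.distrib algebra_simps)
  finally have D: "D / 2 = bilinear_form V A h f + (\<Sum>j\<in>V. f j * h j * (\<Sum>i\<in>V. A i j)) + (\<Sum>j\<in>V. f j * g j)"
    by simp
  have L2h: "L2_set h V \<le> sqrt (hi * X)"
  proof (rule L2_set_le_sqrt)
    have "(h i)\<^sup>2 \<le> hi * (\<pi> i * (f i)\<^sup>2)" if "i \<in> V" for i
      using mult_right_mono[OF \<pi>(2)[OF that], of "\<pi> i * (f i)\<^sup>2"] \<pi>0[OF that] hf[OF that]
      by (simp add: power2_eq_square mult_ac)
    then show "(\<Sum>i\<in>V. (h i)\<^sup>2) \<le> hi * X" unfolding X_def sum_distrib_left by (intro sum_mono)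
  qed
  have L2f: "L2_set f V \<le> sqrt (X / lo)"
  proof (rule L2_set_le_sqrt)
    have "(f i)\<^sup>2 \<le> \<pi> i * (f i)\<^sup>2 / lo" if "i \<in> V" for i
      using mult_right_mono[OF \<pi>(1)[OF that], of "(f i)\<^sup>2"] lo by (simp add: field_simps)
    then show "(\<Sum>i\<in>V. (f i)\<^sup>2) \<le> X / lo" unfolding X_def sum_divide_distrib by (intro sum_mono)
  qed
  have hilo: "sqrt (hi / lo) \<le> sqrt b" using lo by (simp add: divide_le_eq)
  have "bilinear_form V A h f \<le> a * (sqrt (hi * X) * sqrt (X / lo))"
    using A[of h f] a L2h L2f by (elim order_trans) (intro mult_left_mono mult_mono, auto simp: X0 hi less_imp_le)
  also have "sqrt (hi * X) * sqrt (X / lo) = sqrt (hi / lo) * X"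
    using X0 by (simp add: real_sqrt_mult real_sqrt_divide)
  also have "a * (sqrt (hi / lo) * X) \<le> a * (sqrt b * X)"
    using a X0 hilo by (intro mult_left_mono mult_right_mono) auto
  finally have T1: "bilinear_form V A h f \<le> a * sqrt b * X" by simp
  have "(\<Sum>j\<in>V. f j * h j * (\<Sum>i\<in>V. A i j)) \<le> (\<Sum>j\<in>V. (\<pi> j * (f j)\<^sup>2) * \<rho>)"
  proof (rule sum_mono)
    fix j assume j: "j \<in> V"
    have "f j * h j * (\<Sum>i\<in>V. A i j) = (\<pi> j * (f j)\<^sup>2) * (\<Sum>i\<in>V. A i j)"
      using hf[OF j] by (simp add: power2_eq_square)
    also have "\<dots> \<le> (\<pi> j * (f j)\<^sup>2) * \<rho>"
      using rows[OF j] \<pi>0[OF j] by (intro mult_left_mono) auto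
    finally show "f j * h j * (\<Sum>i\<in>V. A i j) \<le> (\<pi> j * (f j)\<^sup>2) * \<rho>" .
  qed
  then have T2: "(\<Sum>j\<in>V. f j * h j * (\<Sum>i\<in>V. A i j)) \<le> \<rho> * X"
    by (simp only: X_def sum_distrib_right[symmetric] mult.commute[of \<rho>])
  have "(\<Sum>j\<in>V. f j * g j) \<le> L2_set f V * G" unfolding G_def by (rule sum_mult_le_L2_set)
  also have "\<dots> \<le> sqrt (X / lo) * G" using L2f G0 by (rule mult_right_mono)
  finally have T3: "(\<Sum>j\<in>V. f j * g j) \<le> sqrt (X / lo) * G" .
  have "X / (6 * b) \<le> (a * sqrt b + \<rho>) * X + sqrt (X / lo) * G"
    using gap D T1 T2 T3 by (simp add: algebra_simps)
  also have "(a * sqrt b + \<rho>) * X \<le> 1 / (12 * b) * X" using small X0 by (rule mult_right_mono)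
  finally have "X / (12 * b) \<le> sqrt (X / lo) * G" using b by (simp add: field_simps)
  then have "sqrt X * sqrt X \<le> sqrt X * (12 * b * G / sqrt lo)"
    using X0 b lo by (simp add: real_sqrt_divide field_simps)
  then have sX: "sqrt X \<le> 12 * b * G / sqrt lo"
  proof (cases "X = 0")
    case True
    then show ?thesis using G0 b lo by simp
  next
    case False
    with X0 have "sqrt X > 0" by simp
    then show ?thesis using \<open>sqrt X * sqrt X \<le> _\<close> mult_le_cancel_left_pos by blast
  qed
  have "L2_set h V \<le> sqrt hi * sqrt X" using L2h by (simp add: real_sqrt_mult)
  also have "\<dots> \<le> sqrt hi * (12 * b * G / sqrt lo)" using sX hi by (intro mult_left_mono) auto
  also have "\<dots> = 12 * b * sqrt (hi / lo) * G" by (simp add: real_sqrt_divide)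
  also have "\<dots> \<le> 12 * b * sqrt b * G" using hilo b G0 by (intro mult_right_mono mult_left_mono) auto
  finally show ?thesis by (simp add: G_def)
qed

section \<open>Existence of stationary distributions\<close>

text \<open>
  Induction on the state space: a state \<open>x\<close> is removed by rerouting each jump \<open>i \<rightarrow> x\<close> to the state at which
  the chain leaves \<open>x\<close>.
\<close>

lemma stationary_vector_exists:
  fixes q :: "'a \<Rightarrow> 'a \<Rightarrow> real"
  assumes "finite V" "V \<noteq> {}" "\<And>i j. i \<in> V \<Longrightarrow> j \<in> V \<Longrightarrow> i \<noteq> j \<Longrightarrow> 0 \<le> q i j"
  shows "\<exists>v. (\<forall>i\<in>V. 0 \<le> v i) \<and> sum v V > 0 \<and>
           (\<forall>j\<in>V. (\<Sum>i\<in>V-{j}. v i * q i j) = v j * (\<Sum>k\<in>V-{j}. q j k))"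
  using assms
proof (induction V arbitrary: q rule: finite_ne_induct)
  case (singleton x)
  show ?case by (intro exI[of _ "\<lambda>_. 1"]) auto
next
  case (insert x F)
  define S where "S = (\<Sum>k\<in>F. q x k)"
  have q0: "0 \<le> q i j" if "i \<in> insert x F" "j \<in> insert x F" "i \<noteq> j" for i j
    using insert.prems that by blast
  have S0: "S \<ge> 0" unfolding S_def using insert.hyps by (intro sum_nonneg q0) auto
  have D1: "insert x F - {x} = F" using insert.hyps by auto
  have D2: "insert x F - {j} = insert x (F - {j})" if "j \<in> F" for j using insert.hyps that by auto
  show ?case
  \<comment> \<open>S is the total rate out of x. If it vanishes, x is absorbing and the point mass
    at x is stationary.\<close>
  proof (cases "S = 0")
    case True
    have qx: "q x j = 0" if "j \<in> F" for j
    proof -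
      have "\<forall>j\<in>F. q x j = 0"
        using True unfolding S_def
        by (subst (asm) sum_nonneg_eq_0_iff) (use insert.hyps in \<open>auto intro!: q0\<close>)
      then show ?thesis using that by blast
    qed
    have s: "(\<Sum>i\<in>F. (if i = x then 1 else 0 :: real)) = 0" using insert.hyps by (auto intro!: sum.neutral)
    show ?thesis
    proof (intro exI[of _ "\<lambda>i. if i = x then 1 else 0"] conjI ballI)
      show "0 < (\<Sum>i\<in>insert x F. if i = x then 1 else 0 :: real)"
        using insert.hyps s by simp
      fix j assume j: "j \<in> insert x F"
      show "(\<Sum>i\<in>insert x F - {j}. (if i = x then 1 else 0) * q i j) =
        (if j = x then 1 else 0) * (\<Sum>k\<in>insert x F - {j}. q j k)"
      proof (cases "j = x")
        case True
        then show ?thesis using insert.hyps \<open>S = 0\<close> by (auto simp: D1 S_def intro!: sum.neutral split: if_splits)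
      next
        case False
        then show ?thesis using j qx by (auto intro!: sum.neutral split: if_splits)
      qed
    qed auto
  next
    case False
    with S0 have Sp: "S > 0" by simp
    define q' where "q' i j = q i j + q i x * q x j / S" for i j
    have "0 \<le> q' i j" if "i \<in> F" "j \<in> F" "i \<noteq> j" for i j
      unfolding q'_def using that insert.hyps(3) less_imp_le[OF Sp]
      by (intro add_nonneg_nonneg divide_nonneg_nonneg mult_nonneg_nonneg q0) auto
    from insert.IH[OF this] obtain v where *: "(\<forall>i\<in>F. 0 \<le> v i) \<and> sum v F > 0 \<and>
        (\<forall>j\<in>F. (\<Sum>i\<in>F-{j}. v i * q' i j) = v j * (\<Sum>k\<in>F-{j}. q' j k))"
      by (rule exE)
    note v = conjunct1[OF *] conjunct1[OF conjunct2[OF *]]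
    note bal = bspec[OF conjunct2[OF conjunct2[OF *]]]
    \<comment> \<open>The weight that the balance equation at x forces: inflow into x divided by the
      exit rate.\<close>
    define c where "c = (\<Sum>i\<in>F. v i * q i x) / S"
    define u where "u i = (if i = x then c else v i)" for i
    have uF: "u i = v i" if "i \<in> F" for i using that insert.hyps by (auto simp: u_def)
    have ux: "u x = c" by (simp add: u_def)
    have c0: "c \<ge> 0" unfolding c_def using v insert.hyps(3) less_imp_le[OF Sp]
      by (intro divide_nonneg_nonneg sum_nonneg mult_nonneg_nonneg q0) auto
    have uFD: "(\<Sum>i\<in>F-{j}. u i * f i) = (\<Sum>i\<in>F-{j}. v i * f i)" for j f
      by (intro sum.cong) (auto simp: uF)
    show ?thesis
    proof (intro exI[of _ u] conjI ballI)
      fix i assume "i \<in> insert x F" then show "0 \<le> u i" using v c0 by (auto simp: u_def)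
    next
      have "sum u F = sum v F" by (intro sum.cong) (auto simp: uF)
      then show "0 < sum u (insert x F)" using v c0 insert.hyps by (simp add: ux)
    next
      fix j assume j: "j \<in> insert x F"
      show "(\<Sum>i\<in>insert x F - {j}. u i * q i j) = u j * (\<Sum>k\<in>insert x F - {j}. q j k)"
      proof (cases "j = x")
        case True
        have "(\<Sum>i\<in>F. u i * q i x) = (\<Sum>i\<in>F. v i * q i x)" by (intro sum.cong) (auto simp: uF)
        then show ?thesis using True Sp by (simp add: D1 ux c_def flip: S_def)
      next
        case False
        with j have jF: "j \<in> F" by simp
        \<comment> \<open>The summand i = j is an excursion from j through x back to j. The
          off-diagonal sums of \<open>q'\<close> omit it, so it is split off here and in
          \<open>Sj\<close>; it adds the same amount to the inflow and the outflow of j.\<close>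
        have cS: "c * q x j = (\<Sum>i\<in>F-{j}. v i * (q i x * q x j / S)) + v j * (q j x * q x j / S)"
        proof -
          have "c * q x j = (\<Sum>i\<in>F. v i * (q i x * q x j / S))"
            unfolding c_def times_divide_eq_left sum_distrib_right sum_divide_distrib
            by (intro sum.cong) (auto simp: mult_ac)
          then show ?thesis using jF insert.hyps by (simp add: sum.remove[of F j])
        qed
        have Sj: "(\<Sum>k\<in>F-{j}. q j x * q x k / S) + q j x * q x j / S = q j x"
        proof -
          have "(\<Sum>k\<in>F. q j x * q x k / S) = q j x * S / S"
            by (simp add: S_def sum_distrib_left sum_divide_distrib)
          then show ?thesis using jF insert.hyps Sp by (simp add: sum.remove[of F j])
        qed
        have "(\<Sum>i\<in>insert x F - {j}. u i * q i j) = c * q x j + (\<Sum>i\<in>F-{j}. v i * q i j)"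
          using insert.hyps by (simp add: D2[OF jF] ux uFD)
        also have "\<dots> = (\<Sum>i\<in>F-{j}. v i * q' i j) + v j * (q j x * q x j / S)"
          unfolding cS by (simp add: q'_def algebra_simps sum.distrib)
        also have "\<dots> = v j * ((\<Sum>k\<in>F-{j}. q j k) + ((\<Sum>k\<in>F-{j}. q j x * q x k / S) + q j x * q x j / S))"
          unfolding bal[OF jF] by (simp add: q'_def algebra_simps sum.distrib)
        also have "\<dots> = u j * (\<Sum>k\<in>insert x F - {j}. q j k)"
          unfolding Sj using insert.hyps by (simp add: D2[OF jF] uF[OF jF])
        finally show ?thesis .
      qed
    qed
  qed
qed

text \<open>The row sum determines \<open>P j j\<close>, so stationarity at j says that inflow
  equals outflow, an equation free of diagonal entries.\<close>

lemma stationary_iff_balance: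
  fixes P :: "'a \<Rightarrow> 'a \<Rightarrow> real"
  assumes "finite V" "j \<in> V" "(\<Sum>k\<in>V. P j k) = 1"
  shows "(\<Sum>i\<in>V. v i * P i j) = v j \<longleftrightarrow> (\<Sum>i\<in>V-{j}. v i * P i j) = v j * (\<Sum>k\<in>V-{j}. P j k)"
proof -
  have "P j j = 1 - (\<Sum>k\<in>V-{j}. P j k)" using assms by (simp add: sum.remove[of V j])
  then have "v j * P j j = v j - v j * (\<Sum>k\<in>V-{j}. P j k)"
    by (simp only: right_diff_distrib mult_1_right)
  moreover have "(\<Sum>i\<in>V. v i * P i j) = v j * P j j + (\<Sum>i\<in>V-{j}. v i * P i j)"
    using assms by (simp add: sum.remove[of V j])
  ultimately show ?thesis by linarith
qed

lemma stationary_distribution_exists: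
  assumes P: "transition_matrix n P" and n: "n \<ge> 1"
  shows "\<exists>v. stationary_distribution n P v"
proof -
  have nonneg: "0 \<le> P i j" if "i \<in> {1..n}" "j \<in> {1..n}" for i j
    using P that by (auto simp: transition_matrix_def)
  have ne: "{1..n} \<noteq> {}" using n by auto
  have "\<exists>v. (\<forall>i\<in>{1..n}. 0 \<le> v i) \<and> sum v {1..n} > 0 \<and>
      (\<forall>j\<in>{1..n}. (\<Sum>i\<in>{1..n}-{j}. v i * P i j) = v j * (\<Sum>k\<in>{1..n}-{j}. P j k))"
    by (rule stationary_vector_exists[OF finite_atLeastAtMost ne nonneg])
  then obtain v where *: "(\<forall>i\<in>{1..n}. 0 \<le> v i) \<and> sum v {1..n} > 0 \<and>
      (\<forall>j\<in>{1..n}. (\<Sum>i\<in>{1..n}-{j}. v i * P i j) = v j * (\<Sum>k\<in>{1..n}-{j}. P j k))"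
    by (rule exE)
  note v = conjunct1[OF *] conjunct1[OF conjunct2[OF *]]
  note bal = conjunct2[OF conjunct2[OF *]]
  define c where "c = sum v {1..n}"
  have stat: "(\<Sum>i\<in>{1..n}. v i * P i j) = v j" if j: "j \<in> {1..n}" for j
    using bal j P by (subst stationary_iff_balance) (auto simp: transition_matrix_def)
  define u where "u i = (if i \<in> {1..n} then v i / c else 0)" for i
  have "(\<Sum>i\<in>{1..n}. u i * P i j) = u j" if j: "j \<in> {1..n}" for j
  proof -
    have "(\<Sum>i\<in>{1..n}. u i * P i j) = (\<Sum>i\<in>{1..n}. v i * P i j) / c"
      unfolding sum_divide_distrib by (intro sum.cong) (auto simp: u_def)
    then show ?thesis using stat[OF j] j by (simp add: u_def)
  qed
  moreover have "(\<Sum>i\<in>{1..n}. u i) = 1"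
  proof -
    have "(\<Sum>i\<in>{1..n}. u i) = c / c"
      unfolding c_def sum_divide_distrib by (intro sum.cong) (auto simp: u_def c_def)
    then show ?thesis using v by (simp add: c_def)
  qed
  ultimately have "stationary_distribution n P u"
    using P v unfolding stationary_distribution_def by (auto simp: u_def c_def)
  then show ?thesis by blast
qed

text \<open>Duality: the image of u under A is tested against itself.\<close>

lemma L2_set_vector_matrix_le:
  assumes A: "\<And>v. bilinear_form V A u v \<le> c * L2_set v V" and c: "c \<ge> 0"
  shows "L2_set (\<lambda>j. \<Sum>i\<in>V. u i * A i j) V \<le> c"
proof -
  let ?v = "\<lambda>j. \<Sum>i\<in>V. u i * A i j"
  have "L2_set ?v V * L2_set ?v V = bilinear_form V A u ?v"
    unfolding power2_eq_square[symmetric] L2_set_power2 bilinear_form_def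
    by (subst sum.swap) (simp add: power2_eq_square flip: sum_distrib_right)
  also have "\<dots> \<le> c * L2_set ?v V" by (rule A)
  finally have "L2_set ?v V * L2_set ?v V \<le> c * L2_set ?v V" .
  then show ?thesis using c L2_set_nonneg[of ?v V]
    by (cases "L2_set ?v V = 0") (auto simp: less_le)
qed

text \<open>Both claims are instances of one energy estimate. The difference of two stationary
  distributions has source 0, which gives uniqueness; \<open>v - \<pi>\<close> has the residual of
  \<pi> as its source. That residual is at most \<open>2 * b * a\<close> times the norm of \<pi>,
  whence 24 = 12 * 2 and one further power of b.\<close>

lemma stationary_distribution_perturbation:
  fixes P A :: "nat \<Rightarrow> nat \<Rightarrow> real" and \<pi> :: "nat \<Rightarrow> real" and lo hi b d a \<rho> :: real
  assumes n: "n \<ge> 1" and P: "transition_matrix n P"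
    and \<pi>: "\<And>i. i \<in> {1..n} \<Longrightarrow> lo \<le> \<pi> i" "\<And>i. i \<in> {1..n} \<Longrightarrow> \<pi> i \<le> hi" "sum \<pi> {1..n} = 1"
    and lo: "0 < lo" "hi \<le> b * lo" and b: "b \<ge> 1" and d: "0 < d" "d \<le> 3 * n"
    and PA: "\<And>i j. i \<in> {1..n} \<Longrightarrow> j \<in> {1..n} \<Longrightarrow> i \<noteq> j \<Longrightarrow> P i j = \<pi> j / (d * (\<pi> i + \<pi> j)) + A i j"
    and skew: "\<And>i j. i \<in> {1..n} \<Longrightarrow> j \<in> {1..n} \<Longrightarrow> A j i = - A i j"
    and A: "\<And>u v. bilinear_form {1..n} A u v \<le> a * (L2_set u {1..n} * L2_set v {1..n})"
    and rows: "\<And>j. j \<in> {1..n} \<Longrightarrow> \<bar>\<Sum>i\<in>{1..n}. A i j\<bar> \<le> \<rho>"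
    and a: "a \<ge> 0" and small: "a * sqrt b + \<rho> \<le> 1 / (12 * b)"
  shows "\<exists>!v. stationary_distribution n P v"
    and "stationary_distribution n P v \<Longrightarrow>
      L2_set (\<lambda>i. v i - \<pi> i) {1..n} \<le> 24 * (b\<^sup>2 * sqrt b) * a * L2_set \<pi> {1..n}"
proof -
  define V where "V = {1..n}"
  have V: "finite V" "V \<noteq> {}" "card V = n" using n by (auto simp: V_def)
  define q where "q i j = \<pi> i * \<pi> j / (d * (\<pi> i + \<pi> j))" for i j
  have \<pi>0: "0 < \<pi> i" if "i \<in> V" for i using \<pi>(1)[of i] lo that by (simp add: V_def)
  have bal: "(\<Sum>i\<in>V. q i j * (v i / \<pi> i - v j / \<pi> j)) + (\<Sum>i\<in>V. (v i + v j) * A i j) = 0"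
    if v: "stationary_distribution n P v" and j: "j \<in> V" for v j
  proof -
    have "(\<Sum>i\<in>V-{j}. v i * P i j) = v j * (\<Sum>k\<in>V-{j}. P j k)"
      using v j P by (subst stationary_iff_balance[symmetric])
        (auto simp: stationary_distribution_def transition_matrix_def V_def)
    then have "0 = (\<Sum>i\<in>V-{j}. v i * P i j - v j * P j i)" by (simp add: sum_subtractf sum_distrib_left)
    also have "\<dots> = (\<Sum>i\<in>V-{j}. q i j * (v i / \<pi> i - v j / \<pi> j) + (v i + v j) * A i j)"
    proof (intro sum.cong refl)
      fix i assume "i \<in> V - {j}"
      then have i: "i \<in> {1..n}" "j \<in> {1..n}" "i \<noteq> j" using j by (auto simp: V_def)
      have p: "\<pi> i > 0" "\<pi> j > 0" using \<pi>0 i by (auto simp: V_def)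
      define x y where "x = \<pi> j / (d * (\<pi> i + \<pi> j))" and "y = \<pi> i / (d * (\<pi> i + \<pi> j))"
      have Pij: "P i j = x + A i j" using PA[OF i] by (simp only: x_def)
      have Pji: "P j i = y - A i j"
        using PA[OF i(2,1) i(3)[symmetric]] skew[OF i(1,2)] by (simp only: y_def add.commute[of "\<pi> j"])
      have "v i * P i j - v j * P j i = (v i * x - v j * y) + (v i + v j) * A i j"
        by (simp add: Pij Pji algebra_simps)
      \<comment> \<open>Detailed balance of the unperturbed chain:
        \<open>\<pi> i * x = \<pi> j * y = q i j\<close>.\<close>
      also have "v i * x - v j * y = q i j * (v i / \<pi> i - v j / \<pi> j)"
        using p by (simp add: x_def y_def q_def right_diff_distrib diff_divide_distrib mult.commute)
      finally show "v i * P i j - v j * P j i = q i j * (v i / \<pi> i - v j / \<pi> j) + (v i + v j) * A i j" .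
    qed
    also have "\<dots> = (\<Sum>i\<in>V. q i j * (v i / \<pi> i - v j / \<pi> j) + (v i + v j) * A i j)"
    proof -
      \<comment> \<open>At i = j both the flow term and, by skew-symmetry, the term with A vanish,
        so the sum may run over all of V.\<close>
      have "A j j = 0" using skew[of j j] j by (simp add: V_def)
      then show ?thesis using V j by (simp add: sum.remove[of V j])
    qed
    finally show ?thesis by (simp add: sum.distrib)
  qed
  have pert: "L2_set h V \<le> 12 * b * sqrt b * L2_set g V"
    if h: "sum h V = 0" and hg: "\<And>j. j \<in> V \<Longrightarrow>
       (\<Sum>i\<in>V. q i j * (h i / \<pi> i - h j / \<pi> j)) + (\<Sum>i\<in>V. (h i + h j) * A i j) + g j = 0" for h g
  proof (rule balance_perturbation[where lo = lo and \<pi> = \<pi> and hi = hi and d = d and A = A and a = a and \<rho> = \<rho>])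
    show "(\<Sum>i\<in>V. \<pi> i * \<pi> j / (d * (\<pi> i + \<pi> j)) * (h i / \<pi> i - h j / \<pi> j))
         + (\<Sum>i\<in>V. (h i + h j) * A i j) + g j = 0" if "j \<in> V" for j
      using hg[OF that] by (simp add: q_def)
  qed (use V \<pi> lo b d A rows a small h in \<open>auto simp: V_def\<close>)
  have sum1: "sum v V = 1" if "stationary_distribution n P v" for v
    using that by (simp add: stationary_distribution_def V_def)
  have uniq: "v = v'" if v: "stationary_distribution n P v" and v': "stationary_distribution n P v'" for v v'
  proof -
    have "L2_set (\<lambda>i. v i - v' i) V \<le> 12 * b * sqrt b * L2_set (\<lambda>_. 0) V"
    proof (rule pert)
      show "(\<Sum>i\<in>V. v i - v' i) = 0" using sum1[OF v] sum1[OF v'] by (simp add: sum_subtractf)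
      fix j assume j: "j \<in> V"
      show "(\<Sum>i\<in>V. q i j * ((v i - v' i) / \<pi> i - (v j - v' j) / \<pi> j)) + (\<Sum>i\<in>V. (v i - v' i + (v j - v' j)) * A i j) + 0 = 0"
        using bal[OF v j] bal[OF v' j]
        by (simp add: diff_divide_distrib algebra_simps sum.distrib sum_subtractf)
    qed
    also have "\<dots> = 0" by (simp add: L2_set_def)
    finally have "L2_set (\<lambda>i. v i - v' i) V = 0" using L2_set_nonneg[of "\<lambda>i. v i - v' i" V] by linarith
    then have "v i = v' i" if "i \<in> V" for i using that V by (simp add: L2_set_eq_0_iff)
    moreover have "v i = v' i" if "i \<notin> V" for i
      using that v v' by (simp add: V_def stationary_distribution_def)
    ultimately show ?thesis by blast
  qed
  show "\<exists>!v. stationary_distribution n P v"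
    using stationary_distribution_exists[OF P n] uniq by blast
  show "L2_set (\<lambda>i. v i - \<pi> i) {1..n} \<le> 24 * (b\<^sup>2 * sqrt b) * a * L2_set \<pi> {1..n}"
    if v: "stationary_distribution n P v"
  proof -
    define g where "g j = (\<Sum>i\<in>V. (\<pi> i + \<pi> j) * A i j)" for j
    have A': "bilinear_form V A u v \<le> a * L2_set u V * L2_set v V" for u v using A[of u v] by (simp add: V_def)
    have "L2_set (\<lambda>i. v i - \<pi> i) V \<le> 12 * b * sqrt b * L2_set g V"
    proof (rule pert)
      show "(\<Sum>i\<in>V. v i - \<pi> i) = 0" using sum1[OF v] \<pi>(3) by (simp add: sum_subtractf V_def)
      fix j assume j: "j \<in> V"
      have e: "(v i - \<pi> i) / \<pi> i - (v j - \<pi> j) / \<pi> j = v i / \<pi> i - v j / \<pi> j" if "i \<in> V" for i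
        using \<pi>0[OF that] \<pi>0[OF j] by (simp add: diff_divide_distrib)
      have "(\<Sum>i\<in>V. q i j * ((v i - \<pi> i) / \<pi> i - (v j - \<pi> j) / \<pi> j)) = (\<Sum>i\<in>V. q i j * (v i / \<pi> i - v j / \<pi> j))"
        by (intro sum.cong refl) (simp only: e)
      moreover have "(\<Sum>i\<in>V. (v i - \<pi> i + (v j - \<pi> j)) * A i j) + g j = (\<Sum>i\<in>V. (v i + v j) * A i j)"
        unfolding g_def sum.distrib[symmetric] by (intro sum.cong refl) (simp add: algebra_simps)
      ultimately show "(\<Sum>i\<in>V. q i j * ((v i - \<pi> i) / \<pi> i - (v j - \<pi> j) / \<pi> j))
          + (\<Sum>i\<in>V. (v i - \<pi> i + (v j - \<pi> j)) * A i j) + g j = 0"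
        using bal[OF v j] by simp
    qed
    also have "L2_set g V \<le> 2 * b * a * L2_set \<pi> V"
    proof -
      have sn: "L2_set (\<lambda>_. c) V = c * sqrt n" if "c \<ge> 0" for c
        using that V by (simp add: L2_set_def real_sqrt_mult)
      \<comment> \<open>The column sums of A. Their L2 norm is at most \<open>a * sqrt n\<close> by
        the operator norm; bounding them by \<rho> instead would carry its logarithm into the final
        rate.\<close>
      define r where "r j = (\<Sum>i\<in>V. 1 * A i j)" for j
      have g: "g j = (\<Sum>i\<in>V. \<pi> i * A i j) + \<pi> j * r j" for j
        by (simp add: g_def r_def distrib_right sum.distrib sum_distrib_left)
      have hi0: "hi > 0" using \<pi>0[of 1] \<pi>(2)[of 1] n by (simp add: V_def)
      have lo_hi: "lo * sqrt n \<le> L2_set \<pi> V"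
      proof -
        have "lo * sqrt n = L2_set (\<lambda>_. lo) V" using sn[of lo] lo by simp
        also have "\<dots> \<le> L2_set \<pi> V" using \<pi>(1) lo by (intro L2_set_mono) (auto simp: V_def)
        finally show ?thesis .
      qed
      have "L2_set g V \<le> L2_set (\<lambda>j. \<Sum>i\<in>V. \<pi> i * A i j) V + L2_set (\<lambda>j. \<pi> j * r j) V"
        unfolding g by (rule L2_set_triangle_ineq)
      also have "L2_set (\<lambda>j. \<Sum>i\<in>V. \<pi> i * A i j) V \<le> a * L2_set \<pi> V"
        using A' a by (intro L2_set_vector_matrix_le) auto
      also have "L2_set (\<lambda>j. \<pi> j * r j) V \<le> L2_set (\<lambda>j. hi * \<bar>r j\<bar>) V"
      proof -
        have "L2_set (\<lambda>j. \<pi> j * r j) V = L2_set (\<lambda>j. \<pi> j * \<bar>r j\<bar>) V" by (simp add: L2_set_def power_mult_distrib)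
        also have "\<dots> \<le> L2_set (\<lambda>j. hi * \<bar>r j\<bar>) V"
          using \<pi>(2) \<pi>0 by (intro L2_set_mono mult_right_mono mult_nonneg_nonneg) (auto simp: V_def less_imp_le)
        finally show ?thesis .
      qed
      also have "\<dots> = hi * L2_set r V"
        using hi0 by (simp add: L2_set_def power_mult_distrib real_sqrt_mult flip: sum_distrib_left)
      also have "\<dots> \<le> hi * (a * sqrt n)"
      proof (intro mult_left_mono)
        show "L2_set r V \<le> a * sqrt n" unfolding r_def
          using A'[of "\<lambda>_. 1"] sn[of 1] a by (intro L2_set_vector_matrix_le) auto
      qed (use hi0 in auto)
      also have "\<dots> \<le> (b * lo) * (a * sqrt n)" using lo a by (intro mult_right_mono) auto
      also have "\<dots> = b * a * (lo * sqrt n)" by simp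
      also have "\<dots> \<le> b * a * L2_set \<pi> V" using lo_hi a b by (intro mult_left_mono) auto
      also have "a * L2_set \<pi> V + b * a * L2_set \<pi> V \<le> 2 * b * a * L2_set \<pi> V"
        using mult_right_mono[OF b, of "a * L2_set \<pi> V"] a by (simp add: algebra_simps)
      finally show ?thesis by simp
    qed
    finally show ?thesis using b by (simp add: V_def power2_eq_square mult_ac)
  qed
qed

section \<open>Concentration for Bernoulli products and random graphs\<close>

text \<open>Hoeffding's inequality for weights of either sign: the k-th variable lies between
  \<open>min 0 (c k)\<close> and \<open>max 0 (c k)\<close>, an interval of length |c k|. If all
  weights are 0, the quotient in the exponent degenerates, but the event is empty because x >
  0.\<close>

lemma Pi_pmf_bernoulli_tail:
  fixes c q :: "'k \<Rightarrow> real"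
  assumes I: "finite I" and q: "\<And>k. k \<in> I \<Longrightarrow> q k \<in> {0..1}"
    and s: "(\<Sum>k\<in>I. (c k)\<^sup>2) \<le> s" and x: "x > 0"
  shows "measure_pmf.prob (Pi_pmf I False (\<lambda>k. bernoulli_pmf (q k)))
           {z. x \<le> (\<Sum>k\<in>I. c k * (of_bool (z k) - q k))} \<le> exp (- 2 * x\<^sup>2 / s)"
proof (cases "(\<Sum>k\<in>I. (c k)\<^sup>2) = 0")
  case True
  then have "\<forall>k\<in>I. c k = 0" using I by (simp add: sum_nonneg_eq_0_iff)
  then have "{z. x \<le> (\<Sum>k\<in>I. c k * (of_bool (z k) - q k))} = {}" using x by auto
  then show ?thesis by simp
next
  case False
  then have pos: "0 < (\<Sum>k\<in>I. (c k)\<^sup>2)" by (simp add: less_le sum_nonneg)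
  define M where "M = Pi_pmf I False (\<lambda>k. bernoulli_pmf (q k))"
  have comp: "map_pmf (\<lambda>z. z k) M = bernoulli_pmf (q k)" if "k \<in> I" for k
    using that I by (simp add: M_def Pi_pmf_component)
  have E: "measure_pmf.expectation M (\<lambda>z. c k * of_bool (z k)) = c k * q k" if "k \<in> I" for k
  proof -
    have "measure_pmf.expectation M (\<lambda>z. c k * of_bool (z k)) =
        measure_pmf.expectation (map_pmf (\<lambda>z. z k) M) (\<lambda>v. c k * of_bool v)" by simp
    also have "\<dots> = c k * q k" unfolding comp[OF that] using q[OF that] by simp
    finally show ?thesis .
  qed
  interpret Hoeffding_ineq "measure_pmf M" I "\<lambda>k z. c k * of_bool (z k)" "\<lambda>k. min 0 (c k)" "\<lambda>k. max 0 (c k)"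
    "\<Sum>k\<in>I. c k * q k"
  proof unfold_locales
    show "prob_space.indep_vars (measure_pmf M) (\<lambda>_. borel) (\<lambda>k z. c k * of_bool (z k)) I"
      unfolding M_def
      by (rule prob_space.indep_vars_compose2[OF measure_pmf.prob_space_axioms indep_vars_Pi_pmf[OF I], where Y="\<lambda>k v. c k * of_bool v"]) auto
    show "(\<Sum>k\<in>I. c k * q k) \<equiv> \<Sum>k\<in>I. measure_pmf.expectation M (\<lambda>z. c k * of_bool (z k))"
      by (rule eq_reflection, rule sum.cong[OF refl], rule E[symmetric])
  qed (use I in \<open>auto simp: min_def max_def\<close>)
  have sq: "(max 0 (c k) - min 0 (c k))\<^sup>2 = (c k)\<^sup>2" for k by (simp add: max_def min_def)
  have "{z. x \<le> (\<Sum>k\<in>I. c k * (of_bool (z k) - q k))} =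
      {z \<in> space (measure_pmf M). (\<Sum>k\<in>I. c k * q k) + x \<le> (\<Sum>k\<in>I. c k * of_bool (z k))}"
    by (auto simp: right_diff_distrib sum_subtractf)
  also have "measure_pmf.prob M \<dots> \<le> exp (- 2 * x\<^sup>2 / (\<Sum>k\<in>I. (c k)\<^sup>2))"
    using Hoeffding_ineq_ge[of x] x pos by (simp add: sq)
  also have "\<dots> \<le> exp (- 2 * x\<^sup>2 / s)" using s pos by (simp add: frac_le)
  finally show ?thesis by (simp add: M_def)
qed

section \<open>Skew-symmetric forms and 2 x 2 minors\<close>

lemma sum_square_eq_sum_ordered_pairs:
  fixes f :: "'a :: linorder \<Rightarrow> 'a \<Rightarrow> 'b :: comm_monoid_add"
  assumes V: "finite V"
  shows "(\<Sum>i\<in>V. \<Sum>j\<in>V. f i j) =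
    (\<Sum>(i, j)\<in>{(i, j). i \<in> V \<and> j \<in> V \<and> i < j}. f i j + f j i) + (\<Sum>i\<in>V. f i i)"
proof -
  let ?P = "{(i, j). i \<in> V \<and> j \<in> V \<and> i < j}"
  have fin: "finite ?P" by (rule finite_subset[of _ "V \<times> V"]) (use V in auto)
  have U: "V \<times> V = (?P \<union> prod.swap ` ?P) \<union> (\<lambda>i. (i, i)) ` V"
    by (auto simp: image_iff; metis linorder_cases)
  have "(\<Sum>i\<in>V. \<Sum>j\<in>V. f i j) = (\<Sum>(i, j)\<in>V \<times> V. f i j)" by (rule sum.cartesian_product)
  also have "\<dots> = (\<Sum>(i, j)\<in>?P \<union> prod.swap ` ?P. f i j) + (\<Sum>(i, j)\<in>(\<lambda>i. (i, i)) ` V. f i j)"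
    by (subst U, rule sum.union_disjoint) (use fin V in auto)
  also have "(\<Sum>(i, j)\<in>?P \<union> prod.swap ` ?P. f i j) = (\<Sum>(i, j)\<in>?P. f i j) + (\<Sum>(i, j)\<in>prod.swap ` ?P. f i j)"
    by (rule sum.union_disjoint) (use fin in auto)
  also have "(\<Sum>(i, j)\<in>prod.swap ` ?P. f i j) = (\<Sum>(i, j)\<in>?P. f j i)"
    by (subst sum.reindex) (auto intro!: sum.cong)
  also have "(\<Sum>(i, j)\<in>(\<lambda>i. (i, i)) ` V. f i j) = (\<Sum>i\<in>V. f i i)"
    by (subst sum.reindex) (auto simp: inj_on_def)
  also have "(\<Sum>(i, j)\<in>?P. f i j) + (\<Sum>(i, j)\<in>?P. f j i) = (\<Sum>(i, j)\<in>?P. f i j + f j i)"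
    unfolding sum.distrib[symmetric] by (intro sum.cong refl) auto
  finally show ?thesis .
qed

text \<open>Lagrange's identity: the left side equals the right side minus the squared inner product
  of u and v.\<close>

lemma sum_minors_le:
  fixes u v :: "'a :: linorder \<Rightarrow> real"
  assumes V: "finite V"
  shows "(\<Sum>(i, j)\<in>{(i, j). i \<in> V \<and> j \<in> V \<and> i < j}. (u i * v j - u j * v i)\<^sup>2)
    \<le> (L2_set u V)\<^sup>2 * (L2_set v V)\<^sup>2"
proof -
  let ?P = "{(i, j). i \<in> V \<and> j \<in> V \<and> i < j}"
  have "2 * (\<Sum>(i, j)\<in>?P. (u i * v j - u j * v i)\<^sup>2) =
      (\<Sum>(i, j)\<in>?P. (u i * v j - u j * v i)\<^sup>2 + (u j * v i - u i * v j)\<^sup>2)"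
    unfolding sum_distrib_left by (intro sum.cong refl) (auto simp: power2_eq_square algebra_simps)
  also have "\<dots> = (\<Sum>i\<in>V. \<Sum>j\<in>V. (u i * v j - u j * v i)\<^sup>2)"
    by (subst sum_square_eq_sum_ordered_pairs[OF V]) simp
  also have "\<dots> = (\<Sum>i\<in>V. \<Sum>j\<in>V. (u i)\<^sup>2 * (v j)\<^sup>2 + (v i)\<^sup>2 * (u j)\<^sup>2 - 2 * ((u i * v i) * (u j * v j)))"
    by (intro sum.cong refl) (simp add: power2_eq_square algebra_simps)
  also have "\<dots> = 2 * ((L2_set u V)\<^sup>2 * (L2_set v V)\<^sup>2) - 2 * (\<Sum>i\<in>V. u i * v i)\<^sup>2"
    unfolding L2_set_power2
    by (simp only: sum.distrib sum_subtractf sum_distrib_left[symmetric] sum_distrib_right[symmetric])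
       (simp add: power2_eq_square)
  finally show ?thesis using zero_le_power2[of "\<Sum>i\<in>V. u i * v i"] by linarith
qed

text \<open>For the noise, the entries with i < j are independent given the graphs. Their weights
  are the minors of u and v, whose sum of squares is controlled by Lagrange's identity.\<close>

lemma bilinear_form_skew:
  fixes A :: "'a :: linorder \<Rightarrow> 'a \<Rightarrow> real"
  assumes V: "finite V" and skew: "\<And>i j. i \<in> V \<Longrightarrow> j \<in> V \<Longrightarrow> A j i = - A i j"
  shows "bilinear_form V A u v =
    (\<Sum>(i, j)\<in>{(i, j). i \<in> V \<and> j \<in> V \<and> i < j}. (u i * v j - u j * v i) * A i j)"
proof -
  have "A i i = 0" if "i \<in> V" for i using skew[OF that that] by simp
  then have "(\<Sum>i\<in>V. u i * A i i * v i) = 0" by (simp add: sum.neutral)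
  moreover have "u i * A i j * v j + u j * A j i * v i = (u i * v j - u j * v i) * A i j"
    if "i \<in> V" "j \<in> V" for i j
    unfolding skew[OF that] by (simp add: algebra_simps)
  ultimately show ?thesis
    unfolding bilinear_form_def sum_square_eq_sum_ordered_pairs[OF V]
    by (auto intro!: sum.cong)
qed

section \<open>Comparison counts of a fixed pair\<close>

lemma map_pmf_edge_erdos_renyi:
  assumes "e \<in> vertex_pairs n"
  shows "map_pmf (\<lambda>E. e \<in> E) (erdos_renyi_pmf n q) = bernoulli_pmf q"
proof -
  have fin: "finite (vertex_pairs n)"
    by (rule finite_subset[of _ "Pow {1..n}"]) (auto simp: vertex_pairs_def)
  show ?thesis using assms Pi_pmf_component[OF fin, of e False "\<lambda>_. bernoulli_pmf q"]
    by (simp add: erdos_renyi_pmf_def pmf.map_comp o_def)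
qed

lemma finite_time_grid: "finite (time_grid T)"
  by (simp add: time_grid_def)

text \<open>Chernoff's bound for the lower tail with the exponential moment at -1. Each time in N
  contributes a factor of at most \<open>exp (- pmin / 2)\<close>, in total
  \<open>exp (- 2 * a)\<close> with \<open>a = card N * pmin / 4\<close>, and the threshold a costs
  \<open>exp a\<close>.\<close>

lemma few_edge_times_prob:
  fixes pmin :: real
  assumes e: "e \<in> vertex_pairs n" and N: "N \<subseteq> time_grid T"
    and p: "\<And>s. s \<in> time_grid T \<Longrightarrow> 0 \<le> p s \<and> p s \<le> 1" "\<And>s. s \<in> N \<Longrightarrow> pmin \<le> p s"
  shows "measure_pmf.prob (graphs_pmf n T p) {G. card {s \<in> N. e \<in> G s} < card N * pmin / 4}
    \<le> exp (- (card N * pmin / 4))"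
proof -
  define a where "a = card N * pmin / 4"
  \<comment> \<open>The value 1 at times outside N extends the product to the whole grid, which is
    the index set of the product measure.\<close>
  define f where "f s E = (if s \<in> N then exp (- of_bool (e \<in> E)) else 1 :: real)" for s and E :: "nat set set"
  have fN: "finite N" using N finite_time_grid finite_subset by blast
  have f01: "0 \<le> f s E" "f s E \<le> 1" for s E by (auto simp: f_def)
  have prodf: "(\<Prod>s\<in>time_grid T. f s (G s)) = exp (- real (card {s \<in> N. e \<in> G s}))" for G
  proof -
    have "(\<Prod>s\<in>time_grid T. f s (G s)) = (\<Prod>s\<in>N. exp (- of_bool (e \<in> G s)))"
      by (rule prod.mono_neutral_cong_right) (use N finite_time_grid in \<open>auto simp: f_def\<close>)
    also have "\<dots> = exp (\<Sum>s\<in>N. - of_bool (e \<in> G s))" using fN by (simp add: exp_sum)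
    also have "(\<Sum>s\<in>N. - of_bool (e \<in> G s) :: real) = - real (card {s \<in> N. e \<in> G s})"
      using fN by (simp add: sum_negf sum_of_bool_eq Int_def)
    finally show ?thesis .
  qed
  have Ef: "measure_pmf.expectation (erdos_renyi_pmf n (p s)) (f s) \<le> (if s \<in> N then exp (- pmin / 2) else 1)"
    if "s \<in> time_grid T" for s
  proof (cases "s \<in> N")
    case True
    have "measure_pmf.expectation (erdos_renyi_pmf n (p s)) (f s) =
      measure_pmf.expectation (map_pmf (\<lambda>E. e \<in> E) (erdos_renyi_pmf n (p s))) (\<lambda>v. exp (- of_bool v))"
      using True by (simp add: f_def[abs_def])
    also have "\<dots> = p s * exp (-1) + (1 - p s)"
      unfolding map_pmf_edge_erdos_renyi[OF e] using p(1)[OF that] by simp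
    also have "\<dots> \<le> 1 - p s / 2"
    proof -
      have "exp (-1 :: real) \<le> 1/2" using exp_ge_add_one_self[of "1::real"] by (simp add: exp_minus field_simps)
      then have "p s * exp (-1) \<le> p s * (1/2)" using p(1)[OF that] by (intro mult_left_mono) auto
      then show ?thesis by simp
    qed
    also have "\<dots> \<le> 1 + (- pmin / 2)" using p(2)[OF True] by simp
    also have "\<dots> \<le> exp (- pmin / 2)" by (rule exp_ge_add_one_self)
    finally show ?thesis using True by simp
  qed (simp add: f_def[abs_def])
  have "measure_pmf.prob (graphs_pmf n T p) {G. card {s \<in> N. e \<in> G s} < a}
      = measure_pmf.expectation (graphs_pmf n T p) (indicator {G. card {s \<in> N. e \<in> G s} < a})"
    by simp
  also have "\<dots> \<le> measure_pmf.expectation (graphs_pmf n T p) (\<lambda>G. exp a * (\<Prod>s\<in>time_grid T. f s (G s)))"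
  proof (rule integral_mono)
    show "integrable (graphs_pmf n T p) (\<lambda>G. exp a * (\<Prod>s\<in>time_grid T. f s (G s)))"
      by (rule measure_pmf.integrable_const_bound[where B="exp a"]) (auto simp: prodf)
    show "indicator {G. card {s \<in> N. e \<in> G s} < a} G \<le> exp a * (\<Prod>s\<in>time_grid T. f s (G s))" for G
      by (auto simp: prodf indicator_def exp_add[symmetric])
  qed (auto intro: measure_pmf.integrable_const_bound[where B=1])
  also have "\<dots> = exp a * (\<Prod>s\<in>time_grid T. measure_pmf.expectation (erdos_renyi_pmf n (p s)) (f s))"
    unfolding graphs_pmf_def
    by (simp, subst expectation_prod_Pi_pmf[OF finite_time_grid])
       (auto simp: f01 intro!: measure_pmf.integrable_const_bound[where B=1])
  also have "\<dots> \<le> exp a * (\<Prod>s\<in>time_grid T. if s \<in> N then exp (- pmin / 2) else 1)"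
    by (intro mult_left_mono prod_mono conjI Ef) (auto simp: f01 intro!: integral_nonneg_AE)
  also have "(\<Prod>s\<in>time_grid T. if s \<in> N then exp (- pmin / 2) else 1) = (\<Prod>s\<in>N. exp (- pmin / 2))"
    by (rule prod.mono_neutral_cong_right) (use N finite_time_grid in auto)
  also have "\<dots> = exp (- 2 * a)" by (simp add: a_def exp_of_nat_mult[symmetric])
  also have "exp a * exp (- 2 * a) = exp (- a)" by (simp add: exp_add[symmetric])
  finally show ?thesis unfolding a_def .
qed

section \<open>Sampling noise\<close>

text \<open>Centred at the win probabilities of the times that are averaged, so that its mean given
  the graphs is 0; the change of these probabilities from s to t belongs to the bias.\<close>

definition sampling_noise ::
    "nat \<Rightarrow> nat \<Rightarrow> (real \<Rightarrow> nat \<Rightarrow> real) \<Rightarrow> real \<Rightarrow> real \<Rightarrow> real \<Rightarrow> (real \<Rightarrow> nat set set)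
      \<Rightarrow> (real \<times> nat \<times> nat \<times> nat \<Rightarrow> bool) \<Rightarrow> nat \<Rightarrow> nat \<Rightarrow> real" where
  "sampling_noise T L w d \<delta> t G z i j =
     (if i = j then 0
      else 1 / (d * real (card (edge_nbhd T G \<delta> t i j)))
             * (\<Sum>s\<in>edge_nbhd T G \<delta> t i j. mean_outcome L z s i j - win_prob w s i j))"

lemma edge_nbhd_commute: "edge_nbhd T G \<delta> t j i = edge_nbhd T G \<delta> t i j"
  by (simp add: edge_nbhd_def insert_commute)

lemma edge_nbhd_subset: "edge_nbhd T G \<delta> t i j \<subseteq> time_grid T"
  by (auto simp: edge_nbhd_def nbhd_def)

lemma finite_edge_nbhd: "finite (edge_nbhd T G \<delta> t i j)"
  using edge_nbhd_subset finite_time_grid by (rule finite_subset)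

lemma win_prob_commute: "w s i > 0 \<Longrightarrow> w s j > 0 \<Longrightarrow> win_prob w s j i = 1 - win_prob w s i j"
  by (simp add: win_prob_def field_simps)

lemma mean_outcome_commute:
  assumes "i \<noteq> j" "L \<ge> 1"
  shows "mean_outcome L z s j i = 1 - mean_outcome L z s i j"
proof -
  have o: "outcome z s j i l = 1 - outcome z s i j l" for l
    using assms by (auto simp: outcome_def)
  show ?thesis unfolding mean_outcome_def o sum_subtractf using assms by (simp add: field_simps)
qed

lemma sampling_noise_skew:
  assumes w: "\<And>s. s \<in> time_grid T \<Longrightarrow> w s i > 0 \<and> w s j > 0" and L: "L \<ge> 1"
  shows "sampling_noise T L w d \<delta> t G z j i = - sampling_noise T L w d \<delta> t G z i j"
proof (cases "i = j")
  case False
  have "(\<Sum>s\<in>edge_nbhd T G \<delta> t i j. mean_outcome L z s j i - win_prob w s j i) =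
      (\<Sum>s\<in>edge_nbhd T G \<delta> t i j. - (mean_outcome L z s i j - win_prob w s i j))"
    using edge_nbhd_subset[of T G \<delta> t i j] w
    by (intro sum.cong refl) (auto simp: mean_outcome_commute[OF False L] win_prob_commute[of w _ i j] subset_iff)
  also have "\<dots> = - (\<Sum>s\<in>edge_nbhd T G \<delta> t i j. mean_outcome L z s i j - win_prob w s i j)"
    by (rule sum_negf)
  finally show ?thesis using False by (simp add: sampling_noise_def edge_nbhd_commute[of _ _ _ _ j i])
qed (simp add: sampling_noise_def)

lemma finite_observation_index:
  assumes "\<And>s. s \<in> time_grid T \<Longrightarrow> G s \<subseteq> vertex_pairs n"
  shows "finite (observation_index T L G)"
proof (rule finite_subset)
  show "observation_index T L G \<subseteq> time_grid T \<times> {1..n} \<times> {1..n} \<times> {1..L}"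
    using assms by (fastforce simp: observation_index_def vertex_pairs_def)
qed (use finite_time_grid in auto)

text \<open>Links the coordinates of the product measure with the sums over pairs and comparison
  times that define the estimator. Observations outside the window receive weight 0.\<close>

lemma sum_observation_index:
  fixes F :: "real \<Rightarrow> nat \<Rightarrow> nat \<Rightarrow> nat \<Rightarrow> real"
  assumes G: "\<And>s. s \<in> time_grid T \<Longrightarrow> G s \<subseteq> vertex_pairs n"
  shows "(\<Sum>(s, i, j, l)\<in>observation_index T L G. if s \<in> nbhd T \<delta> t then F s i j l else 0) =
    (\<Sum>(i, j)\<in>{(i, j). i \<in> {1..n} \<and> j \<in> {1..n} \<and> i < j}.
       \<Sum>s\<in>edge_nbhd T G \<delta> t i j. \<Sum>l\<in>{1..L}. F s i j l)"
proof -
  let ?P = "{(i, j). i \<in> {1..n} \<and> j \<in> {1..n} \<and> i < j}"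
  let ?I = "{(s, i, j, l) \<in> observation_index T L G. s \<in> nbhd T \<delta> t}"
  let ?S = "SIGMA ij:?P. edge_nbhd T G \<delta> t (fst ij) (snd ij) \<times> {1..L}"
  have finP: "finite ?P" by (rule finite_subset[of _ "{1..n} \<times> {1..n}"]) auto
  have "(\<Sum>(i, j)\<in>?P. \<Sum>s\<in>edge_nbhd T G \<delta> t i j. \<Sum>l\<in>{1..L}. F s i j l) =
      (\<Sum>ij\<in>?P. \<Sum>(s, l)\<in>edge_nbhd T G \<delta> t (fst ij) (snd ij) \<times> {1..L}. F s (fst ij) (snd ij) l)"
    by (intro sum.cong refl) (auto simp: sum.cartesian_product)
  also have "\<dots> = (\<Sum>(ij, s, l)\<in>?S. F s (fst ij) (snd ij) l)"
    by (subst sum.Sigma) (use finP finite_edge_nbhd in \<open>auto intro!: sum.cong\<close>)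
  also have "\<dots> = (\<Sum>(s, i, j, l)\<in>?I. F s i j l)"
  proof (rule sum.reindex_bij_witness[where i="\<lambda>(s, i, j, l). ((i, j), s, l)" and j="\<lambda>((i, j), s, l). (s, i, j, l)"])
    show "(\<lambda>(s, i, j, l). ((i, j), s, l)) k \<in> ?S" if "k \<in> ?I" for k
    proof -
      obtain s i j l where k: "k = (s, i, j, l)" by (cases k) auto
      \<comment> \<open>\<open>observation_index\<close> puts no bound n on i and j; it is inherited
        from the edges of the graph.\<close>
      have "{i, j} \<in> vertex_pairs n" using that G by (auto simp: k observation_index_def)
      then show ?thesis using that by (auto simp: k observation_index_def edge_nbhd_def vertex_pairs_def)
    qed
    show "(\<lambda>((i, j), s, l). (s, i, j, l)) k \<in> ?I" if "k \<in> ?S" for k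
      using that by (auto simp: observation_index_def edge_nbhd_def nbhd_def)
  qed auto
  also have "\<dots> = (\<Sum>(s, i, j, l)\<in>observation_index T L G. if s \<in> nbhd T \<delta> t then F s i j l else 0)"
    by (rule sum.mono_neutral_cong_left) (use finite_observation_index[of T G n, OF G] in \<open>auto split: if_splits\<close>)
  finally show ?thesis by simp
qed

text \<open>The form is a weighted sum of centred outcomes. A pair compared at m times has m L of
  them, each of weight \<gamma> / (d m L) with \<gamma> a minor of u and v. Since m >= K, the
  squared weights sum to at most \<open>s / (d\<^sup>2 * L * K)\<close>.\<close>

lemma bilinear_form_noise_tail:
  fixes d K :: real
  assumes w: "\<And>s i. s \<in> time_grid T \<Longrightarrow> i \<in> {1..n} \<Longrightarrow> w s i > 0"
    and L: "L \<ge> 1" and d: "d > 0" and K: "K > 0"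
    and G: "\<And>s. s \<in> time_grid T \<Longrightarrow> G s \<subseteq> vertex_pairs n"
    and count: "\<And>i j. i \<in> {1..n} \<Longrightarrow> j \<in> {1..n} \<Longrightarrow> i \<noteq> j \<Longrightarrow> K \<le> card (edge_nbhd T G \<delta> t i j)"
    and x: "x > 0" and s: "(L2_set u {1..n})\<^sup>2 * (L2_set v {1..n})\<^sup>2 \<le> s"
  shows "measure_pmf.prob (outcomes_pmf T L w G)
           {z. x \<le> bilinear_form {1..n} (sampling_noise T L w d \<delta> t G z) u v}
    \<le> exp (- 2 * (d\<^sup>2 * L * K) * x\<^sup>2 / s)"
proof -
  let ?P = "{(i, j). i \<in> {1..n} \<and> j \<in> {1..n} \<and> i < j}"
  let ?I = "observation_index T L G"
  define \<gamma> where "\<gamma> i j = u i * v j - u j * v i" for i j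
  define N where "N i j = edge_nbhd T G \<delta> t i j" for i j
  define m where "m i j = real (card (N i j))" for i j
  define \<kappa> where "\<kappa> = d\<^sup>2 * L * K"
  have \<kappa>: "\<kappa> > 0" using d L K by (simp add: \<kappa>_def)
  have m: "K \<le> m i j" if "(i, j) \<in> ?P" for i j
    using count[of i j] that by (auto simp: m_def N_def)
  define q where "q = (\<lambda>(s, i, j, l :: nat). win_prob w s i j)"
  define c where "c = (\<lambda>(s, i, j, l :: nat). if s \<in> nbhd T \<delta> t then \<gamma> i j / (d * m i j * L) else 0)"
  have fin: "finite ?I" by (rule finite_observation_index[OF G])
  have q01: "q k \<in> {0..1}" if "k \<in> ?I" for k
  proof -
    obtain s i j l where k: "k = (s, i, j, l)" by (cases k) auto
    have s: "s \<in> time_grid T" using that by (auto simp: k observation_index_def)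
    have "{i, j} \<in> vertex_pairs n" using that G by (auto simp: k observation_index_def)
    then have "w s i > 0" "w s j > 0" using w[OF s] by (auto simp: vertex_pairs_def)
    then show ?thesis by (simp add: k q_def win_prob_def)
  qed
  have pmf: "outcomes_pmf T L w G = Pi_pmf ?I False (\<lambda>k. bernoulli_pmf (q k))"
    unfolding outcomes_pmf_def q_def by (rule arg_cong[where f="Pi_pmf ?I False"]) auto
  have c2: "(\<Sum>k\<in>?I. (c k)\<^sup>2) \<le> s / \<kappa>"
  proof -
    have "(\<Sum>k\<in>?I. (c k)\<^sup>2) =
      (\<Sum>(s, i, j, l)\<in>?I. if s \<in> nbhd T \<delta> t then (\<gamma> i j / (d * m i j * L))\<^sup>2 else 0)"
      by (intro sum.cong refl) (auto simp: c_def)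
    also have "\<dots> = (\<Sum>(i, j)\<in>?P. \<Sum>s\<in>N i j. \<Sum>l\<in>{1..L}. (\<gamma> i j / (d * m i j * L))\<^sup>2)"
      unfolding N_def by (rule sum_observation_index[OF G])
    also have "\<dots> = (\<Sum>(i, j)\<in>?P. m i j * L * (\<gamma> i j / (d * m i j * L))\<^sup>2)"
      by (simp add: m_def mult.assoc)
    also have "\<dots> \<le> (\<Sum>(i, j)\<in>?P. (\<gamma> i j)\<^sup>2 / \<kappa>)"
    proof (intro sum_mono, clarify)
      fix i j assume "i \<in> {1..n}" "j \<in> {1..n}" "i < j"
      then have mK: "K \<le> m i j" by (intro m) auto
      have "m i j * L * (\<gamma> i j / (d * m i j * L))\<^sup>2 = (\<gamma> i j)\<^sup>2 / (d\<^sup>2 * L * m i j)"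
        using mK K L d by (simp add: power2_eq_square field_simps)
      also have "\<dots> \<le> (\<gamma> i j)\<^sup>2 / \<kappa>"
        unfolding \<kappa>_def using mK K L d by (intro divide_left_mono mult_left_mono) auto
      finally show "m i j * L * (\<gamma> i j / (d * m i j * L))\<^sup>2 \<le> (\<gamma> i j)\<^sup>2 / \<kappa>" .
    qed
    also have "\<dots> = (\<Sum>(i, j)\<in>?P. (\<gamma> i j)\<^sup>2) / \<kappa>" by (simp add: sum_divide_distrib case_prod_beta)
    also have "\<dots> \<le> s / \<kappa>"
      using order_trans[OF sum_minors_le[of "{1..n}" u v] s] \<kappa>
      by (intro divide_right_mono) (auto simp: \<gamma>_def)
    finally show ?thesis .
  qed
  have form: "bilinear_form {1..n} (sampling_noise T L w d \<delta> t G z) u v = (\<Sum>k\<in>?I. c k * (of_bool (z k) - q k))" for z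
  proof -
    have "bilinear_form {1..n} (sampling_noise T L w d \<delta> t G z) u v =
        (\<Sum>(i, j)\<in>?P. \<gamma> i j * sampling_noise T L w d \<delta> t G z i j)"
      unfolding \<gamma>_def by (intro bilinear_form_skew sampling_noise_skew L) (use w in auto)
    also have "\<dots> = (\<Sum>(i, j)\<in>?P. \<Sum>s\<in>N i j. \<Sum>l\<in>{1..L}. \<gamma> i j / (d * m i j * L) * (of_bool (z (s, i, j, l)) - win_prob w s i j))"
    proof (intro sum.cong refl, clarify)
      fix i j assume ij: "i \<in> {1..n}" "j \<in> {1..n}" "i < j"
      have "mean_outcome L z s i j - win_prob w s i j = (\<Sum>l\<in>{1..L}. of_bool (z (s, i, j, l)) - win_prob w s i j) / L" for s
        using ij L by (simp add: mean_outcome_def outcome_def sum_subtractf field_simps)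
      then have "sampling_noise T L w d \<delta> t G z i j
          = 1 / (d * m i j) * (\<Sum>s\<in>N i j. (\<Sum>l\<in>{1..L}. of_bool (z (s, i, j, l)) - win_prob w s i j) / L)"
        using ij by (simp add: sampling_noise_def m_def N_def)
      then show "\<gamma> i j * sampling_noise T L w d \<delta> t G z i j =
          (\<Sum>s\<in>N i j. \<Sum>l\<in>{1..L}. \<gamma> i j / (d * m i j * L) * (of_bool (z (s, i, j, l)) - win_prob w s i j))"
        by (simp only: sum_distrib_left[symmetric] sum_divide_distrib[symmetric]) simp
    qed
    also have "\<dots> = (\<Sum>(s, i, j, l)\<in>?I. if s \<in> nbhd T \<delta> t then \<gamma> i j / (d * m i j * L) * (of_bool (z (s, i, j, l)) - win_prob w s i j) else 0)"
      unfolding N_def by (rule sum_observation_index[OF G, symmetric])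
    also have "\<dots> = (\<Sum>k\<in>?I. c k * (of_bool (z k) - q k))"
      by (intro sum.cong refl) (auto simp: c_def q_def)
    finally show ?thesis .
  qed
  have "measure_pmf.prob (outcomes_pmf T L w G)
      {z. x \<le> bilinear_form {1..n} (sampling_noise T L w d \<delta> t G z) u v} \<le> exp (- 2 * x\<^sup>2 / (s / \<kappa>))"
    unfolding form pmf by (rule Pi_pmf_bernoulli_tail[OF fin q01 c2 x])
  then show ?thesis by (simp add: \<kappa>_def mult_ac)
qed

text \<open>Bounds the net by \<open>exp (14 * n)\<close> points, hence the pairs of net points by
  \<open>exp (28 * n)\<close>, which a tail of \<open>exp (- 29 * n)\<close> outweighs.\<close>

lemma three_times_2_power_16_le: "(3 * 2 ^ 16 :: real) \<le> exp 14"
proof -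
  have "(5/2 :: real) \<le> exp 1" using exp_lower_Taylor_quadratic[of "1::real"] by simp
  then have "(5/2 :: real) ^ 14 \<le> exp 1 ^ 14" by (intro power_mono) auto
  also have "\<dots> = exp 14" by (simp flip: exp_of_nat_mult)
  finally show ?thesis by (simp add: power_divide)
qed

lemma noise_concentration:
  fixes n T L :: nat and K d :: real
  assumes n: "n \<ge> 2"
    and w: "\<And>s i. s \<in> time_grid T \<Longrightarrow> i \<in> {1..n} \<Longrightarrow> w s i > 0"
    and L: "L \<ge> 1" and d: "d > 0" and K: "K > 0"
    and G: "\<And>s. s \<in> time_grid T \<Longrightarrow> G s \<subseteq> vertex_pairs n"
    and count: "\<And>i j. i \<in> {1..n} \<Longrightarrow> j \<in> {1..n} \<Longrightarrow> i \<noteq> j \<Longrightarrow> K \<le> card (edge_nbhd T G \<delta> t i j)"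
  defines "\<kappa> \<equiv> d\<^sup>2 * L * K"
  shows "measure_pmf.prob (outcomes_pmf T L w G)
      {z. \<not> ((\<forall>u v. bilinear_form {1..n} (sampling_noise T L w d \<delta> t G z) u v
                 \<le> sqrt (58 * n / \<kappa>) * (L2_set u {1..n} * L2_set v {1..n})) \<and>
              (\<forall>j\<in>{1..n}. \<bar>\<Sum>i\<in>{1..n}. sampling_noise T L w d \<delta> t G z i j\<bar> \<le> sqrt (6 * n * ln n / \<kappa>)))}
    \<le> exp (- real n) + 2 / real n ^ 10"
proof -
  define V where "V = {1..n}"
  define \<Lambda> where "\<Lambda> = lattice_points V"
  define A where "A z = sampling_noise T L w d \<delta> t G z" for z
  define M where "M = outcomes_pmf T L w G"
  \<comment> \<open>Makes the tail equal to \<open>exp (- 29 * n)\<close> for each pair of net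
    points. The passage from the net to all vectors doubles x, whence 58 = 4 * 29 / 2.\<close>
  define x where "x = sqrt (29 * n / (2 * \<kappa>))"
  \<comment> \<open>A constant vector with entries 1 or -1 has squared norm n, so the tail at y is
    n^(-12) for each column.\<close>
  define y where "y = sqrt (6 * n * ln n / \<kappa>)"
  have \<kappa>: "\<kappa> > 0" using d L K by (simp add: \<kappa>_def)
  have x0: "x > 0" and y0: "y > 0" using n \<kappa> by (auto simp: x_def y_def)
  have V: "finite V" "card V = n" by (auto simp: V_def)
  have fin: "finite \<Lambda>" unfolding \<Lambda>_def by (rule finite_lattice_points[OF V(1)])
  have tail: "measure_pmf.prob M {z. r \<le> bilinear_form V (A z) u v} \<le> exp (- 2 * \<kappa> * r\<^sup>2 / s)"
    if "r > 0" "(L2_set u V)\<^sup>2 * (L2_set v V)\<^sup>2 \<le> s" for r s u v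
    using bilinear_form_noise_tail[OF w L d K G count that(1) that(2)[unfolded V_def]]
    by (simp add: M_def A_def \<kappa>_def V_def)
  have net1: "(L2_set (net_vector V a) V)\<^sup>2 \<le> 1" if "a \<in> \<Lambda>" for a
  proof -
    have "real_of_int (\<Sum>i\<in>V. (a i)\<^sup>2) \<le> 16 * real n"
      using that V unfolding \<Lambda>_def lattice_points_def by (simp flip: of_int_le_iff[where 'a=real])
    then show ?thesis using n V
      by (simp add: L2_set_power2 net_vector_def power_divide power_mult_distrib flip: sum_divide_distrib)
  qed
  define E1 where "E1 = (\<Union>(a, b)\<in>\<Lambda> \<times> \<Lambda>. {z. x \<le> bilinear_form V (A z) (net_vector V a) (net_vector V b)})"
  \<comment> \<open>A column sum is the form in a constant vector and a unit vector; c = 1 and c =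
    -1 give the two sides of its absolute value.\<close>
  define E2 where "E2 c = (\<Union>j\<in>V. {z. y \<le> bilinear_form V (A z) (\<lambda>_. c) (\<lambda>i. of_bool (i = j))})" for c :: real
  have "measure_pmf.prob M E1 \<le> (\<Sum>ab\<in>\<Lambda> \<times> \<Lambda>. measure_pmf.prob M
      (case ab of (a, b) \<Rightarrow> {z. x \<le> bilinear_form V (A z) (net_vector V a) (net_vector V b)}))"
    unfolding E1_def by (rule measure_pmf.finite_measure_subadditive_finite) (use fin in auto)
  also have "\<dots> \<le> (\<Sum>ab\<in>\<Lambda> \<times> \<Lambda>. exp (- 29 * n))"
  proof (intro sum_mono, clarify)
    fix a b assume ab: "a \<in> \<Lambda>" "b \<in> \<Lambda>"
    have "(L2_set (net_vector V a) V)\<^sup>2 * (L2_set (net_vector V b) V)\<^sup>2 \<le> 1"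
      using net1[OF ab(1)] net1[OF ab(2)] by (intro mult_le_one) auto
    from tail[OF x0 this] have "measure_pmf.prob M {z. x \<le> bilinear_form V (A z) (net_vector V a) (net_vector V b)}
        \<le> exp (- 2 * \<kappa> * x\<^sup>2 / 1)" .
    also have "- 2 * \<kappa> * x\<^sup>2 / 1 = - 29 * n" using \<kappa> n by (simp add: x_def)
    finally show "measure_pmf.prob M {z. x \<le> bilinear_form V (A z) (net_vector V a) (net_vector V b)} \<le> exp (- 29 * n)" .
  qed
  also have "\<dots> = (real (card \<Lambda>))\<^sup>2 * exp (- 29 * n)" by (simp add: card_cartesian_product power2_eq_square)
  also have "\<dots> \<le> (exp (14 * n))\<^sup>2 * exp (- 29 * n)"
  proof (intro mult_right_mono power_mono)
    have "real (card \<Lambda>) \<le> (3 * 2 ^ 16) ^ n" using card_lattice_points[OF V(1)] by (simp add: \<Lambda>_def V)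
    also have "\<dots> \<le> exp 14 ^ n" using three_times_2_power_16_le by (intro power_mono) auto
    finally show "real (card \<Lambda>) \<le> exp (14 * n)" by (simp add: exp_of_nat_mult mult.commute flip: exp_of_nat_mult)
  qed auto
  also have "\<dots> = exp (- real n)" by (simp add: power2_eq_square flip: exp_add)
  finally have E1: "measure_pmf.prob M E1 \<le> exp (- real n)" .
  have E2: "measure_pmf.prob M (E2 c) \<le> 1 / real n ^ 10" if c: "\<bar>c\<bar> = 1" for c
  proof -
    have c2: "c\<^sup>2 = 1" using c by (metis one_power2 power2_abs)
    have "measure_pmf.prob M (E2 c) \<le> (\<Sum>j\<in>V. measure_pmf.prob M
        {z. y \<le> bilinear_form V (A z) (\<lambda>_. c) (\<lambda>i. of_bool (i = j))})"
      unfolding E2_def by (rule measure_pmf.finite_measure_subadditive_finite) (use V in auto)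
    also have "\<dots> \<le> (\<Sum>j\<in>V. 1 / real n ^ 12)"
    proof (intro sum_mono)
      fix j assume j: "j \<in> V"
      have "(\<Sum>i\<in>V. (of_bool (i = j) :: real)\<^sup>2) = (\<Sum>i\<in>V. if i = j then 1 else 0)"
        by (intro sum.cong) auto
      then have "(L2_set (\<lambda>_. c) V)\<^sup>2 * (L2_set (\<lambda>i. of_bool (i = j)) V)\<^sup>2 \<le> real n"
        unfolding L2_set_power2 using j V c2 by simp
      from tail[OF y0 this] have "measure_pmf.prob M {z. y \<le> bilinear_form V (A z) (\<lambda>_. c) (\<lambda>i. of_bool (i = j))}
        \<le> exp (- 2 * \<kappa> * y\<^sup>2 / n)" .
      also have "- 2 * \<kappa> * y\<^sup>2 / n = - (real 12 * ln n)" using \<kappa> n by (simp add: y_def)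
      also have "exp \<dots> = 1 / real n ^ 12"
        unfolding exp_minus exp_of_nat_mult using n by (simp add: inverse_eq_divide)
      finally show "measure_pmf.prob M {z. y \<le> bilinear_form V (A z) (\<lambda>_. c) (\<lambda>i. of_bool (i = j))} \<le> 1 / real n ^ 12" .
    qed
    also have "\<dots> = 1 / real n ^ 11" using n V by (simp add: power_Suc[of _ 11, simplified])
    also have "\<dots> \<le> 1 / real n ^ 10" using n by (intro divide_left_mono power_increasing) auto
    finally show ?thesis .
  qed
  have sub: "{z. \<not> ((\<forall>u v. bilinear_form V (A z) u v \<le> sqrt (58 * n / \<kappa>) * (L2_set u V * L2_set v V)) \<and>
      (\<forall>j\<in>V. \<bar>\<Sum>i\<in>V. A z i j\<bar> \<le> y))} \<subseteq> E1 \<union> (E2 1 \<union> E2 (-1))"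
  proof (rule subsetI, rule ccontr)
    fix z assume z: "z \<in> {z. \<not> ((\<forall>u v. bilinear_form V (A z) u v \<le> sqrt (58 * n / \<kappa>) * (L2_set u V * L2_set v V)) \<and>
      (\<forall>j\<in>V. \<bar>\<Sum>i\<in>V. A z i j\<bar> \<le> y))}" and nz: "z \<notin> E1 \<union> (E2 1 \<union> E2 (-1))"
    have "bilinear_form V (A z) (net_vector V a) (net_vector V b) \<le> x" if "a \<in> \<Lambda>" "b \<in> \<Lambda>" for a b
      using nz that by (auto simp: E1_def not_le intro: less_imp_le)
    then have "bilinear_form V (A z) u v \<le> 2 * x * (L2_set u V * L2_set v V)" for u v
      by (intro bilinear_form_le_from_net[OF V(1)]) (auto simp: \<Lambda>_def)
    moreover have "2 * x = sqrt (58 * n / \<kappa>)"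
    proof -
      have "2 * x = sqrt 4 * x" by simp
      also have "\<dots> = sqrt (58 * n / \<kappa>)" unfolding x_def real_sqrt_mult[symmetric] using \<kappa> by (simp add: field_simps)
      finally show ?thesis .
    qed
    moreover have "\<bar>\<Sum>i\<in>V. A z i j\<bar> \<le> y" if j: "j \<in> V" for j
    proof -
      have "bilinear_form V (A z) (\<lambda>_. c) (\<lambda>i. of_bool (i = j)) = c * (\<Sum>i\<in>V. A z i j)" for c
      proof -
        have "(\<Sum>k\<in>V. c * A z i k * of_bool (k = j)) = (\<Sum>k\<in>V. if k = j then c * A z i j else 0)" for i
          by (intro sum.cong) auto
        then show ?thesis using j V by (simp add: bilinear_form_def sum_distrib_left)
      qed
      then show ?thesis using nz j by (auto simp: E2_def not_le abs_le_iff intro: less_imp_le)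
    qed
    ultimately show False using z by simp
  qed
  have "measure_pmf.prob M (E1 \<union> (E2 1 \<union> E2 (-1))) \<le> measure_pmf.prob M E1 + (measure_pmf.prob M (E2 1) + measure_pmf.prob M (E2 (-1)))"
    by (intro order_trans[OF measure_Un_le] add_left_mono measure_Un_le) auto
  also have "\<dots> \<le> exp (- real n) + (1 / real n ^ 10 + 1 / real n ^ 10)"
    using E2[of 1] E2[of "-1"] by (intro add_mono E1) auto
  finally have "measure_pmf.prob M (E1 \<union> (E2 1 \<union> E2 (-1))) \<le> exp (- real n) + 2 / real n ^ 10" by simp
  moreover have "measure_pmf.prob M {z. \<not> ((\<forall>u v. bilinear_form V (A z) u v \<le> sqrt (58 * n / \<kappa>) * (L2_set u V * L2_set v V)) \<and>
      (\<forall>j\<in>V. \<bar>\<Sum>i\<in>V. A z i j\<bar> \<le> y))} \<le> measure_pmf.prob M (E1 \<union> (E2 1 \<union> E2 (-1)))"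
    by (rule measure_pmf.finite_measure_mono[OF sub]) simp
  ultimately show ?thesis unfolding M_def V_def A_def y_def by linarith
qed

section \<open>Error of the estimator\<close>

lemma cond_number_ge:
  assumes "i \<in> {1..n}" "j \<in> {1..n}"
  shows "w t i / w t j \<le> cond_number n w t"
proof -
  let ?S = "{w t i / w t j | i j. i \<in> {1..n} \<and> j \<in> {1..n}}"
  have "?S \<subseteq> (\<lambda>(i, j). w t i / w t j) ` ({1..n} \<times> {1..n})" by auto
  then have "finite ?S" by (rule finite_subset) simp
  moreover have "w t i / w t j \<in> ?S" using assms by blast
  ultimately show ?thesis unfolding cond_number_def by (rule Max_ge)
qed

lemma cond_number_ge_1:
  assumes "n \<ge> 1" "\<And>i. i \<in> {1..n} \<Longrightarrow> w t i > 0"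
  shows "1 \<le> cond_number n w t"
  using cond_number_ge[of 1 n 1 w t] assms(2)[of 1] assms(1) by simp

lemma time_grid_subset: "time_grid T \<subseteq> {0..1}"
  by (auto simp: time_grid_def divide_le_eq)

section \<open>The estimated matrix and its decomposition into noise and bias\<close>

lemma mean_outcome_bounds:
  assumes "L \<ge> 1"
  shows "0 \<le> mean_outcome L z s i j" "mean_outcome L z s i j \<le> 1"
proof -
  have o: "0 \<le> outcome z s i j l \<and> outcome z s i j l \<le> 1" for l by (auto simp: outcome_def)
  then show "0 \<le> mean_outcome L z s i j" by (simp add: mean_outcome_def sum_nonneg)
  have "(\<Sum>l\<in>{1..L}. outcome z s i j l) \<le> (\<Sum>l\<in>{1..L}. 1)" using o by (intro sum_mono) auto
  then show "mean_outcome L z s i j \<le> 1" using assms by (simp add: mean_outcome_def divide_le_eq)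
qed

lemma P_hat_offdiag_bounds:
  assumes "L \<ge> 1" "d > 0"
  shows "0 \<le> P_hat_offdiag T L d \<delta> t G z i j" "P_hat_offdiag T L d \<delta> t G z i j \<le> 1 / d"
proof -
  let ?N = "edge_nbhd T G \<delta> t i j"
  have s: "0 \<le> (\<Sum>s\<in>?N. mean_outcome L z s i j)" "(\<Sum>s\<in>?N. mean_outcome L z s i j) \<le> (\<Sum>s\<in>?N. 1)"
    by (intro sum_nonneg sum_mono mean_outcome_bounds assms(1))+
  then show "0 \<le> P_hat_offdiag T L d \<delta> t G z i j" using assms by (simp add: P_hat_offdiag_def)
  show "P_hat_offdiag T L d \<delta> t G z i j \<le> 1 / d"
  \<comment> \<open>With an empty set of times the quotient by 0 is 0, so both branches of
    \<open>P_hat_offdiag\<close> give the entry 0.\<close>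
  proof (cases "card ?N = 0")
    case False
    then show ?thesis using s assms by (simp add: P_hat_offdiag_def field_simps)
  qed (use assms in \<open>simp add: P_hat_offdiag_def\<close>)
qed

text \<open>The n - 1 off-diagonal entries of a row are at most 1 / d each, so
  \<open>d \<ge> n\<close> keeps the diagonal nonnegative.\<close>

lemma transition_matrix_P_hat:
  assumes L: "L \<ge> 1" and d: "real n \<le> d" "d > 0"
  shows "transition_matrix n (P_hat n T L d \<delta> t G z)"
  unfolding transition_matrix_def
proof (intro ballI conjI)
  let ?Q = "P_hat_offdiag T L d \<delta> t G z"
  fix i j assume i: "i \<in> {1..n}" and j: "j \<in> {1..n}"
  have "(\<Sum>k\<in>{1..n} - {i}. ?Q i k) \<le> (\<Sum>k\<in>{1..n} - {i}. 1 / d)"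
    by (intro sum_mono P_hat_offdiag_bounds L d)
  also have "\<dots> = real (n - 1) / d" using i by simp
  also have "\<dots> \<le> 1" using d by (simp add: divide_le_eq)
  finally show "0 \<le> P_hat n T L d \<delta> t G z i j"
    using P_hat_offdiag_bounds(1)[OF L d(2), of T \<delta> t G z i j] by (auto simp: P_hat_def)
next
  fix i assume i: "i \<in> {1..n}"
  have "(\<Sum>j\<in>{1..n} - {i}. P_hat n T L d \<delta> t G z i j) = (\<Sum>k\<in>{1..n} - {i}. P_hat_offdiag T L d \<delta> t G z i k)"
    by (intro sum.cong) (auto simp: P_hat_def)
  then have "P_hat n T L d \<delta> t G z i i + (\<Sum>j\<in>{1..n} - {i}. P_hat n T L d \<delta> t G z i j) = 1"
    by (simp add: P_hat_def)
  then show "(\<Sum>j\<in>{1..n}. P_hat n T L d \<delta> t G z i j) = 1"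
    using i by (simp only: sum.remove[OF finite_atLeastAtMost i])
qed

text \<open>Cauchy-Schwarz for the two l1-norms costs a factor \<open>card V\<close>. The bias can
  afford it: its entries are of size \<beta> / d with \<open>d \<ge> n\<close>.\<close>

lemma bilinear_form_le_entrywise:
  fixes B :: "'a \<Rightarrow> 'a \<Rightarrow> real"
  assumes B: "\<And>i j. i \<in> V \<Longrightarrow> j \<in> V \<Longrightarrow> \<bar>B i j\<bar> \<le> \<epsilon>" and \<epsilon>: "\<epsilon> \<ge> 0"
  shows "bilinear_form V B u v \<le> \<epsilon> * card V * (L2_set u V * L2_set v V)"
proof -
  have s: "(\<Sum>i\<in>V. \<bar>f i\<bar>) \<le> sqrt (card V) * L2_set f V" for f :: "'a \<Rightarrow> real"
    using L2_set_mult_ineq[where f = "\<lambda>_. 1" and g = f and A = V] by (simp add: L2_set_def)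
  have "bilinear_form V B u v \<le> (\<Sum>i\<in>V. \<Sum>j\<in>V. \<epsilon> * (\<bar>u i\<bar> * \<bar>v j\<bar>))"
    unfolding bilinear_form_def
  proof (intro sum_mono)
    fix i j assume ij: "i \<in> V" "j \<in> V"
    have "u i * B i j * v j \<le> \<bar>B i j\<bar> * (\<bar>u i\<bar> * \<bar>v j\<bar>)"
      using abs_ge_self[of "u i * B i j * v j"] by (simp add: abs_mult mult_ac)
    also have "\<dots> \<le> \<epsilon> * (\<bar>u i\<bar> * \<bar>v j\<bar>)" using B[OF ij] by (intro mult_right_mono) auto
    finally show "u i * B i j * v j \<le> \<epsilon> * (\<bar>u i\<bar> * \<bar>v j\<bar>)" .
  qed
  also have "\<dots> = \<epsilon> * ((\<Sum>i\<in>V. \<bar>u i\<bar>) * (\<Sum>j\<in>V. \<bar>v j\<bar>))"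
    unfolding sum_product unfolding sum_distrib_left ..
  also have "\<dots> \<le> \<epsilon> * ((sqrt (card V) * L2_set u V) * (sqrt (card V) * L2_set v V))"
    using \<epsilon> s by (intro mult_left_mono mult_mono) (auto intro: sum_nonneg)
  also have "\<dots> = \<epsilon> * card V * (L2_set u V * L2_set v V)" by (simp add: mult_ac flip: real_sqrt_mult)
  finally show ?thesis .
qed

text \<open>The deterministic part of the argument. The perturbation A is the noise plus the bias
  matrix B, and B adds at most \<beta> to the operator norm and to each column sum.\<close>

lemma rank_centrality_error:
  fixes d \<beta> a \<rho> :: real
  assumes n: "n \<ge> 1" and L: "L \<ge> 1"
    and w: "\<And>s i. s \<in> {0..1} \<Longrightarrow> i \<in> {1..n} \<Longrightarrow> w s i > 0" and t: "t \<in> {0..1}"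
    and d: "real n \<le> d" "d \<le> 3 * n"
    and smooth: "\<And>s i j. s \<in> nbhd T \<delta> t \<Longrightarrow> i \<in> {1..n} \<Longrightarrow> j \<in> {1..n} \<Longrightarrow> i \<noteq> j \<Longrightarrow>
        \<bar>win_prob w s i j - win_prob w t i j\<bar> \<le> \<beta>" and \<beta>: "\<beta> \<ge> 0"
    and complete: "\<And>i j. i \<in> {1..n} \<Longrightarrow> j \<in> {1..n} \<Longrightarrow> i \<noteq> j \<Longrightarrow> edge_nbhd T G \<delta> t i j \<noteq> {}"
    and op: "\<And>u v. bilinear_form {1..n} (sampling_noise T L w d \<delta> t G z) u v \<le> a * (L2_set u {1..n} * L2_set v {1..n})"
    and rows: "\<And>j. j \<in> {1..n} \<Longrightarrow> \<bar>\<Sum>i\<in>{1..n}. sampling_noise T L w d \<delta> t G z i j\<bar> \<le> \<rho>"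
    and a: "a \<ge> 0"
    and small: "(a + \<beta>) * sqrt (cond_number n w t) + (\<rho> + \<beta>) \<le> 1 / (12 * cond_number n w t)"
  defines "P \<equiv> P_hat n T L d \<delta> t G z" and "b \<equiv> cond_number n w t"
  shows "\<exists>!v. stationary_distribution n P v"
    and "L2_set (\<lambda>i. the_stationary_distribution n P i - pi_star n w t i) {1..n} / L2_set (pi_star n w t) {1..n}
      \<le> 24 * (b\<^sup>2 * sqrt b) * (a + \<beta>)"
proof -
  define V where "V = {1..n}"
  define \<pi> where "\<pi> = pi_star n w t"
  define E where "E = sampling_noise T L w d \<delta> t G z"
  define N where "N i j = edge_nbhd T G \<delta> t i j" for i j
  define m where "m i j = real (card (N i j))" for i j
  define B where "B i j = (if i = j then 0 else 1 / (d * m i j) * (\<Sum>s\<in>N i j. win_prob w s i j - win_prob w t i j))" for i j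
  define A where "A i j = E i j + B i j" for i j
  have V: "finite V" "card V = n" "V \<noteq> {}" using n by (auto simp: V_def)
  have d0: "d > 0" using d n by simp
  have wt: "w t i > 0" if "i \<in> V" for i using w[OF t] that by (simp add: V_def)
  have wg: "w s i > 0" if "s \<in> time_grid T" "i \<in> V" for s i using w[of s i] subsetD[OF time_grid_subset that(1)] that(2) by (simp add: V_def)
  have m0: "m i j > 0" if "i \<in> V" "j \<in> V" "i \<noteq> j" for i j
    using complete[of i j] finite_edge_nbhd[of T G \<delta> t i j] that by (simp add: V_def m_def N_def card_gt_0_iff)
  define W where "W = sum (w t) V"
  have W: "W > 0" unfolding W_def using V wt by (intro sum_pos) auto
  have pi: "\<pi> i = w t i / W" for i by (simp add: \<pi>_def pi_star_def W_def V_def)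
  have \<pi>0: "\<pi> i > 0" if "i \<in> V" for i using wt[OF that] W by (simp add: pi)
  have win: "win_prob w t i j = \<pi> j / (\<pi> i + \<pi> j)" for i j
    using W by (simp add: win_prob_def pi field_simps)
  have Bbound: "\<bar>B i j\<bar> \<le> \<beta> / d" if ij: "i \<in> V" "j \<in> V" for i j
  proof (cases "i = j")
    case False
    have "\<bar>\<Sum>s\<in>N i j. win_prob w s i j - win_prob w t i j\<bar> \<le> (\<Sum>s\<in>N i j. \<beta>)"
      using smooth[OF _ ij[unfolded V_def] False]
      by (intro order_trans[OF sum_abs] sum_mono) (auto simp: N_def edge_nbhd_def)
    also have "\<dots> = m i j * \<beta>" by (simp add: m_def)
    finally show ?thesis using m0[OF ij False] d0 False by (simp add: B_def abs_mult field_simps)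
  qed (use d0 \<beta> in \<open>simp add: B_def\<close>)
  have Bskew: "B j i = - B i j" if ij: "i \<in> V" "j \<in> V" for i j
  proof (cases "i = j")
    case False
    have Nc: "N j i = N i j" by (simp add: N_def edge_nbhd_commute)
    have "(\<Sum>s\<in>N i j. win_prob w s j i - win_prob w t j i) = (\<Sum>s\<in>N i j. - (win_prob w s i j - win_prob w t i j))"
    proof (intro sum.cong refl)
      fix s assume "s \<in> N i j"
      then have s: "s \<in> time_grid T" by (auto simp: N_def edge_nbhd_def nbhd_def)
      show "win_prob w s j i - win_prob w t j i = - (win_prob w s i j - win_prob w t i j)"
        using win_prob_commute[of w s i j] win_prob_commute[of w t i j] wg[OF s] wt ij by simp
    qed
    also have "\<dots> = - (\<Sum>s\<in>N i j. win_prob w s i j - win_prob w t i j)" by (rule sum_negf)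
    finally show ?thesis using False by (simp add: B_def m_def Nc)
  qed (simp add: B_def)
  have skew: "A j i = - A i j" if "i \<in> {1..n}" "j \<in> {1..n}" for i j
    using sampling_noise_skew[of T w i j L d \<delta> t G z] Bskew[of i j] wg that L by (simp add: A_def E_def V_def)
  have PA: "P i j = \<pi> j / (d * (\<pi> i + \<pi> j)) + A i j" if ij: "i \<in> {1..n}" "j \<in> {1..n}" "i \<noteq> j" for i j
  proof -
    have mp: "m i j > 0" using m0 ij by (simp add: V_def)
    have "{i, j} \<in> union_edges T G \<delta> t"
      using complete[OF ij] by (auto simp: union_edges_def edge_nbhd_def)
    then have "P i j = 1 / (d * m i j) * (\<Sum>s\<in>N i j. mean_outcome L z s i j)"
      using ij by (simp add: P_def P_hat_def P_hat_offdiag_def m_def N_def)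
    \<comment> \<open>Noise, bias and the probability at time t itself, in this order.\<close>
    also have "(\<Sum>s\<in>N i j. mean_outcome L z s i j) = (\<Sum>s\<in>N i j. mean_outcome L z s i j - win_prob w s i j)
        + ((\<Sum>s\<in>N i j. win_prob w s i j - win_prob w t i j) + m i j * win_prob w t i j)"
      by (simp add: sum_subtractf m_def)
    also have "1 / (d * m i j) * \<dots> = A i j + win_prob w t i j / d"
      using mp d0 ij by (simp add: A_def E_def B_def sampling_noise_def distrib_left m_def N_def)
    finally show ?thesis by (simp add: win)
  qed
  define lo where "lo = Min (\<pi> ` V)"
  define hi where "hi = Max (\<pi> ` V)"
  have lo: "lo \<le> \<pi> i" and hi: "\<pi> i \<le> hi" if "i \<in> V" for i
    unfolding lo_def hi_def using that V by (auto intro: Min_le Max_ge)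
  have "lo \<in> \<pi> ` V" "hi \<in> \<pi> ` V" unfolding lo_def hi_def using V by (auto intro!: Min_in Max_in)
  then obtain i0 i1 where i0: "i0 \<in> V" "lo = \<pi> i0" and i1: "i1 \<in> V" "hi = \<pi> i1" by blast
  have lo0: "lo > 0" using i0 \<pi>0 by simp
  have hilo: "hi \<le> b * lo"
  proof -
    have "w t i1 / w t i0 \<le> b" unfolding b_def by (rule cond_number_ge) (use i0 i1 in \<open>auto simp: V_def\<close>)
    then show ?thesis using i0 i1 W wt[OF i0(1)] by (simp add: pi divide_le_eq)
  qed
  have b1: "b \<ge> 1" unfolding b_def by (rule cond_number_ge_1) (use n wt in \<open>auto simp: V_def\<close>)
  have sum1: "sum \<pi> {1..n} = 1" using W by (simp add: pi W_def V_def flip: sum_divide_distrib)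
  have nd: "\<beta> / d * n \<le> \<beta>" using d d0 \<beta> by (simp add: divide_le_eq mult_left_mono)
  have opA: "bilinear_form {1..n} A u v \<le> (a + \<beta>) * (L2_set u {1..n} * L2_set v {1..n})" for u v
  proof -
    have "bilinear_form V B u v \<le> \<beta> / d * card V * (L2_set u V * L2_set v V)"
      by (rule bilinear_form_le_entrywise) (use Bbound \<beta> d0 in auto)
    also have "\<dots> \<le> \<beta> * (L2_set u V * L2_set v V)"
      using nd V by (intro mult_right_mono) auto
    finally have "bilinear_form V B u v \<le> \<beta> * (L2_set u V * L2_set v V)" .
    moreover have "bilinear_form V A u v = bilinear_form V E u v + bilinear_form V B u v"
      by (simp add: bilinear_form_def A_def algebra_simps sum.distrib)
    ultimately show ?thesis using op[of u v] by (simp add: E_def V_def algebra_simps)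
  qed
  have rowsA: "\<bar>\<Sum>i\<in>{1..n}. A i j\<bar> \<le> \<rho> + \<beta>" if j: "j \<in> {1..n}" for j
  proof -
    have "\<bar>\<Sum>i\<in>V. B i j\<bar> \<le> (\<Sum>i\<in>V. \<beta> / d)"
      using Bbound j by (intro order_trans[OF sum_abs] sum_mono) (auto simp: V_def)
    also have "\<dots> \<le> \<beta>" using nd V by (simp add: mult.commute)
    finally have "\<bar>\<Sum>i\<in>V. B i j\<bar> \<le> \<beta>" .
    then show ?thesis using rows[OF j] by (simp add: A_def E_def V_def sum.distrib)
  qed
  have trans: "transition_matrix n P" unfolding P_def by (rule transition_matrix_P_hat[OF L d(1) d0])
  note pert = stationary_distribution_perturbation[where \<pi> = \<pi> and A = A and lo = lo and hi = hi and b = b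
      and d = d and a = "a + \<beta>" and \<rho> = "\<rho> + \<beta>", OF n trans lo[unfolded V_def] hi[unfolded V_def] sum1 lo0 hilo b1
      d0 d(2) PA skew opA rowsA add_nonneg_nonneg[OF a \<beta>] small[folded b_def]]
  show ex: "\<exists>!v. stationary_distribution n P v" by (rule pert(1))
  have st: "stationary_distribution n P (the_stationary_distribution n P)"
    unfolding the_stationary_distribution_def by (rule theI'[OF ex])
  have "L2_set (\<lambda>i. the_stationary_distribution n P i - \<pi> i) {1..n} \<le> 24 * (b\<^sup>2 * sqrt b) * (a + \<beta>) * L2_set \<pi> {1..n}"
    by (rule pert(2)) (use st in auto)
  moreover have "L2_set \<pi> {1..n} > 0"
  proof -
    have "L2_set \<pi> V \<noteq> 0" using V(1) i0(1) \<pi>0[OF i0(1)] by (auto simp: L2_set_eq_0_iff intro!: bexI[of _ i0])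
    then show ?thesis using L2_set_nonneg[of \<pi> V] by (simp add: V_def less_le)
  qed
  ultimately show "L2_set (\<lambda>i. the_stationary_distribution n P i - pi_star n w t i) {1..n} / L2_set (pi_star n w t) {1..n}
      \<le> 24 * (b\<^sup>2 * sqrt b) * (a + \<beta>)"
    by (simp add: divide_le_eq \<pi>_def)
qed

section \<open>The rates as functions of the bandwidth\<close>

lemma bias_rate_eq:
  assumes "T \<ge> 1"
  shows "bias_rate n T L M b pmin = bandwidth n T L M b pmin / T"
proof -
  have T: "real T powr (2/3) / real T = 1 / real T powr (1/3)"
  proof -
    have "real T powr (1/3) * real T powr (2/3) = real T" using assms by (simp flip: powr_add)
    then show ?thesis using assms by (simp add: field_simps)
  qed
  define X where "X = b powr (2/3) / ((2 * M) powr (2/3) * real n * (real L * pmin) powr (1/3))"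
  have "X * real T powr (2/3) / real T = X * (1 / real T powr (1/3))"
    unfolding T[symmetric] by simp
  also have "\<dots> = b powr (2/3) / ((2 * M) powr (2/3) * real n * (real L * pmin) powr (1/3) * real T powr (1/3))"
    by (simp add: X_def)
  finally have X: "X * real T powr (2/3) / real T = \<dots>" .
  have "min x (real T) / real T = min (x / real T) 1" for x
    using assms by (simp add: min_def divide_le_eq)
  then show ?thesis using assms X by (simp add: bias_rate_def bandwidth_def X_def)
qed

lemma powr_third_square: "x > 0 \<Longrightarrow> (x powr (1/3))\<^sup>2 = x powr (2/3)" for x :: real
  by (simp add: power2_eq_square flip: powr_add)

lemma powr_sixth_square: "x > 0 \<Longrightarrow> (x powr (1/6))\<^sup>2 = x powr (1/3)" for x :: real
  by (simp add: power2_eq_square flip: powr_add)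

text \<open>The first term of the maximum squares to the reciprocal of the first term of the minimum
  in \<open>bandwidth\<close>, so the maximum is one over the root of that minimum. For M = 0 the
  first term of the maximum is 0, because \<open>0 powr (1/3) = 0\<close>, and the bandwidth is
  T.\<close>

lemma noise_rate_eq:
  assumes T: "T \<ge> 1" and n: "n \<ge> 1" and L: "L \<ge> 1" and M: "M \<ge> 0" and b: "b > 0" and p: "pmin > 0"
  shows "noise_rate n T L M b pmin = 1 / sqrt (bandwidth n T L M b pmin)"
proof (cases "M = 0")
  case True
  then show ?thesis by (simp add: noise_rate_def bandwidth_def)
next
  case False
  with M have M0: "M > 0" by simp
  define X where "X = b powr (2/3) / ((2 * M) powr (2/3) * real n * (real L * pmin) powr (1/3)) * real T powr (2/3)"
  define Y where "Y = (2 * M) powr (1/3) * real n powr (1/2) * (real L * pmin) powr (1/6) / (b powr (1/3) * real T powr (1/3))"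
  have pos: "X > 0" "Y > 0" using M0 n L p b T by (auto simp: X_def Y_def)
  have "Y\<^sup>2 = (2 * M) powr (2/3) * real n * (real L * pmin) powr (1/3) / (b powr (2/3) * real T powr (2/3))"
    using M0 n L p b T
    by (simp add: Y_def power_divide power_mult_distrib powr_third_square powr_sixth_square powr_half_sqrt)
  also have "\<dots> = 1 / X" by (simp add: X_def)
  finally have "Y = sqrt (1 / X)" using pos by (metis abs_of_pos real_sqrt_abs)
  then have Y: "Y = 1 / sqrt X" by (simp add: real_sqrt_divide)
  have "max (1 / sqrt X) (1 / sqrt T) = 1 / sqrt (min X T)"
    using pos T by (auto simp: max_def min_def field_simps)
  then show ?thesis using False Y by (simp add: noise_rate_def bandwidth_def X_def Y_def)
qed

text \<open>The window around t may stick out of [0, 1]. In grid units, the interval from x to x +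
  \<delta> lies inside [0, T] and within distance \<delta> of \<tau>. It contains at least \<delta>
  - 1 integers, and \<delta> - 1 >= \<delta> / 2 because \<delta> >= 2.\<close>

lemma card_nbhd_ge:
  assumes T: "T \<ge> 1" and \<delta>: "2 \<le> \<delta>" "\<delta> \<le> T" and t: "t \<in> {0..1}"
  shows "\<delta> / 2 \<le> card (nbhd T \<delta> t)"
proof -
  define \<tau> where "\<tau> = t * T"
  have \<tau>: "0 \<le> \<tau>" "\<tau> \<le> T" using t by (auto simp: \<tau>_def mult_left_le_one_le)
  define x where "x = min \<tau> (T - \<delta>)"
  have x: "0 \<le> x" "x + \<delta> \<le> T" "\<tau> - \<delta> \<le> x" "x \<le> \<tau>" using \<tau> \<delta> by (auto simp: x_def)
  define I where "I = {nat \<lceil>x\<rceil>..nat \<lfloor>x + \<delta>\<rfloor>}"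
  have mem: "x \<le> real i \<and> real i \<le> x + \<delta>" if "i \<in> I" for i
    using that x \<delta> unfolding I_def by (auto simp: nat_le_iff le_nat_iff ceiling_le_iff le_floor_iff)
  have "(\<lambda>i. real i / real T) ` I \<subseteq> nbhd T \<delta> t"
  proof (clarsimp simp: nbhd_def)
    fix i assume "i \<in> I"
    then have i: "x \<le> real i" "real i \<le> x + \<delta>" using mem by auto
    have "t - real i / real T = (\<tau> - real i) / T" using T by (simp add: \<tau>_def diff_divide_distrib)
    then have "\<bar>t - real i / real T\<bar> = \<bar>\<tau> - real i\<bar> / T" by simp
    also have "\<dots> \<le> \<delta> / T" using i x by (intro divide_right_mono) auto
    finally show "real i / real T \<in> time_grid T \<and> \<bar>t - real i / real T\<bar> \<le> \<delta> / real T"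
      using i x by (auto simp: time_grid_def)
  qed
  moreover have "finite (nbhd T \<delta> t)" using finite_time_grid by (simp add: nbhd_def)
  ultimately have "card ((\<lambda>i. real i / real T) ` I) \<le> card (nbhd T \<delta> t)" by (intro card_mono)
  moreover have "card ((\<lambda>i. real i / real T) ` I) = card I" using T by (intro card_image) (auto simp: inj_on_def)
  moreover have "\<delta> - 1 \<le> card I"
    using x \<delta> unfolding I_def by simp linarith
  ultimately show ?thesis using \<delta> by linarith
qed

text \<open>Conditioning on the first stage, here the graphs: on D the conditional probability is
  bounded by 1, elsewhere by e.\<close>

lemma prob_bind_pmf_le:
  assumes "\<And>x. x \<in> set_pmf p \<Longrightarrow> x \<notin> D \<Longrightarrow> measure_pmf.prob (f x) B \<le> e" and e: "e \<ge> 0"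
  shows "measure_pmf.prob (bind_pmf p f) B \<le> measure_pmf.prob p D + e"
proof -
  have "ennreal (measure_pmf.prob (bind_pmf p f) B) = (\<integral>\<^sup>+x. emeasure (f x) B \<partial>p)"
    by (simp add: measure_pmf.emeasure_eq_measure[symmetric] emeasure_bind_pmf)
  also have "\<dots> \<le> (\<integral>\<^sup>+x. indicator D x + ennreal e \<partial>p)"
  proof (intro nn_integral_mono_AE AE_pmfI)
    fix x assume x: "x \<in> set_pmf p"
    show "emeasure (f x) B \<le> indicator D x + ennreal e"
    proof (cases "x \<in> D")
      case True
      have "emeasure (f x) B \<le> 1" by (rule measure_pmf.emeasure_le_1)
      also have "\<dots> \<le> 1 + ennreal e" by simp
      finally show ?thesis using True by simp
    next
      case False
      then show ?thesis using assms(1)[OF x] by (simp add: measure_pmf.emeasure_eq_measure ennreal_leI)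
    qed
  qed
  also have "\<dots> = ennreal (measure_pmf.prob p D + e)"
    using e by (simp add: nn_integral_add measure_pmf.emeasure_eq_measure)
  finally show ?thesis using e by (subst (asm) ennreal_le_iff) auto
qed

section \<open>Exceptional graphs and numerical bounds\<close>

lemma graphs_pmf_subset:
  assumes "G \<in> set_pmf (graphs_pmf n T p)" "s \<in> time_grid T"
  shows "G s \<subseteq> vertex_pairs n"
proof -
  have "G s \<in> set_pmf (erdos_renyi_pmf n (p s))"
    using assms set_Pi_pmf_subset'[OF finite_time_grid, of T "{}" "\<lambda>s. erdos_renyi_pmf n (p s)"]
    by (auto simp: graphs_pmf_def PiE_dflt_def)
  then show ?thesis by (auto simp: erdos_renyi_pmf_def)
qed

text \<open>Union bound over at most n^2 ordered pairs; the 12 in the hypothesis makes each pair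
  fail with probability at most n^(-12).\<close>

lemma sparse_pair_prob:
  fixes pmin \<delta> t :: real
  assumes n: "n \<ge> 1"
    and p: "\<And>s. s \<in> time_grid T \<Longrightarrow> 0 \<le> p s \<and> p s \<le> 1" "\<And>s. s \<in> time_grid T \<Longrightarrow> pmin \<le> p s"
    and K: "12 * ln n \<le> card (nbhd T \<delta> t) * pmin / 4"
  shows "measure_pmf.prob (graphs_pmf n T p)
      {G. \<exists>i\<in>{1..n}. \<exists>j\<in>{1..n}. i \<noteq> j \<and> card (edge_nbhd T G \<delta> t i j) < card (nbhd T \<delta> t) * pmin / 4}
    \<le> 1 / real n ^ 10"
proof -
  define S where "S = {(i, j). i \<in> {1..n} \<and> j \<in> {1..n} \<and> i \<noteq> j}"
  define N where "N = nbhd T \<delta> t"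
  define D where "D e = {G. card {s \<in> N. e \<in> G s} < card N * pmin / 4}" for e :: "nat set"
  have SV: "S \<subseteq> {1..n} \<times> {1..n}" by (auto simp: S_def)
  have finS: "finite S" using SV by (rule finite_subset) simp
  have "card S \<le> n * n" using card_mono[OF _ SV] by simp
  then have cS: "real (card S) \<le> real n ^ 2" by (simp add: power2_eq_square flip: of_nat_mult)
  have eN: "edge_nbhd T G \<delta> t i j = {s \<in> N. {i, j} \<in> G s}" for G i j by (simp add: edge_nbhd_def N_def)
  have "{G. \<exists>i\<in>{1..n}. \<exists>j\<in>{1..n}. i \<noteq> j \<and> card (edge_nbhd T G \<delta> t i j) < card (nbhd T \<delta> t) * pmin / 4}
      = (\<Union>(i, j)\<in>S. D {i, j})"
    unfolding S_def D_def eN N_def[symmetric] by blast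
  also have "measure_pmf.prob (graphs_pmf n T p) \<dots> \<le> (\<Sum>x\<in>S. measure_pmf.prob (graphs_pmf n T p) (case x of (i, j) \<Rightarrow> D {i, j}))"
    by (rule measure_pmf.finite_measure_subadditive_finite[OF finS]) auto
  also have "\<dots> \<le> (\<Sum>x\<in>S. 1 / real n ^ 12)"
  proof (intro sum_mono, clarify)
    fix i j assume ij: "(i, j) \<in> S"
    have "measure_pmf.prob (graphs_pmf n T p) (D {i, j}) \<le> exp (- (card N * pmin / 4))"
      unfolding D_def
      by (rule few_edge_times_prob) (use ij p in \<open>auto simp: S_def vertex_pairs_def N_def nbhd_def\<close>)
    also have "\<dots> \<le> exp (- (real 12 * ln n))" using K by (simp add: N_def)
    also have "\<dots> = 1 / real n ^ 12"
      unfolding exp_minus exp_of_nat_mult using n by (simp add: inverse_eq_divide)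
    finally show "measure_pmf.prob (graphs_pmf n T p) (D {i, j}) \<le> 1 / real n ^ 12" .
  qed
  also have "\<dots> = real (card S) / real n ^ 12" by simp
  also have "\<dots> \<le> real n ^ 2 / real n ^ 12" using cS by (rule divide_right_mono) simp
  also have "\<dots> = 1 / real n ^ 10" using n by (simp add: divide_simps flip: power_add)
  finally show ?thesis .
qed

text \<open>The tenth power of n / 10 <= exp (n / 10). It is the origin of 10^10 in the failure
  constant.\<close>

lemma exp_minus_le_inverse_power:
  assumes "n \<ge> 1"
  shows "exp (- real n) \<le> 10 ^ 10 / real n ^ 10"
proof -
  have "real n / 10 \<le> exp (real n / 10)" using exp_ge_add_one_self[of "real n / 10"] by linarith
  then have "(real n / 10) ^ 10 \<le> exp (real n / 10) ^ 10" by (intro power_mono) auto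
  also have "\<dots> = exp (real n)" by (simp flip: exp_of_nat_mult)
  finally have "real n ^ 10 / 10 ^ 10 \<le> exp (real n)" by (simp add: power_divide)
  then show ?thesis using assms by (simp add: exp_minus field_simps)
qed

text \<open>A fixed edge is missing throughout the window with probability at most
  \<open>exp (-1)\<close>, which is below 1/2. Hence the normalization d lies between 3 n / 2 and 3
  n.\<close>

lemma union_prob_bounds:
  fixes pmin :: real
  assumes p: "\<And>s. s \<in> time_grid T \<Longrightarrow> 0 \<le> p s \<and> p s \<le> 1" "\<And>s. s \<in> time_grid T \<Longrightarrow> pmin \<le> p s"
    and c: "1 \<le> card (nbhd T \<delta> t) * pmin"
  shows "1 / 2 \<le> union_prob T p \<delta> t" "union_prob T p \<delta> t \<le> 1"
proof -
  let ?N = "nbhd T \<delta> t"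
  have N: "s \<in> time_grid T" if "s \<in> ?N" for s using that by (simp add: nbhd_def)
  have "(\<Prod>s\<in>?N. 1 - p s) \<le> (\<Prod>s\<in>?N. exp (- pmin))"
  proof (intro prod_mono conjI)
    fix s assume s: "s \<in> ?N"
    show "0 \<le> 1 - p s" using p(1)[OF N[OF s]] by simp
    show "1 - p s \<le> exp (- pmin)" using p(2)[OF N[OF s]] exp_ge_add_one_self[of "- pmin"] by linarith
  qed
  also have "\<dots> = exp (- (card ?N * pmin))" by (simp flip: exp_of_nat_mult)
  also have "\<dots> \<le> exp (-1)" using c by simp
  also have "\<dots> \<le> 1 / 2" using exp_ge_add_one_self[of "1::real"] by (simp add: exp_minus field_simps)
  finally show "1 / 2 \<le> union_prob T p \<delta> t" by (simp add: union_prob_def)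
  have "0 \<le> (\<Prod>s\<in>?N. 1 - p s)" using p(1) N by (intro prod_nonneg) auto
  then show "union_prob T p \<delta> t \<le> 1" by (simp add: union_prob_def)
qed

text \<open>
  Here \<open>R\<close> stands for \<open>L n p\<^sub>m\<^sub>i\<^sub>n \<delta>\<close> and \<open>\<beta>\<close> for the bias \<open>M \<delta> / T\<close> of a single comparison probability.
\<close>

lemma rate_constants:
  fixes n :: nat and R \<beta> b \<kappa> :: real
  assumes n: "n \<ge> 2" and R: "R > 0" and \<beta>: "\<beta> \<ge> 0" and b: "b \<ge> 1" and \<kappa>: "n * R / 4 \<le> \<kappa>"
    and small: "sqrt (ln n / R) + n * \<beta> \<le> 1 / 300 * (1 / b powr (7/2))"
  shows "(sqrt (58 * n / \<kappa>) + \<beta>) * sqrt b + (sqrt (6 * n * ln n / \<kappa>) + \<beta>) \<le> 1 / (12 * b)"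
    and "24 * (b\<^sup>2 * sqrt b) * (sqrt (58 * n / \<kappa>) + \<beta>) \<le> 384 * (n * \<beta> * b powr (7/2) + b powr (9/2) / sqrt R)"
proof -
  define r where "r = sqrt (ln n / R)"
  have ln: "2 / 3 \<le> ln (real n)"
  proof -
    have "ln 2 \<le> ln (real n)" using n by simp
    then show ?thesis using ln2_ge_two_thirds by linarith
  qed
  have nR: "n * R / 4 > 0" using n R by simp
  \<comment> \<open>The lower bound on \<kappa> costs a factor 4: below, 4 * 58 = 232 is rounded up
    to 16^2 and 4 * 6 = 24 to 5^2.\<close>
  have inv: "n * c / \<kappa> \<le> 4 * c / R" if "c \<ge> 0" for c :: real
  proof -
    have "n * c / \<kappa> \<le> n * c / (n * R / 4)" using \<kappa> nR that by (intro divide_left_mono) auto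
    also have "\<dots> = 4 * c / R" using n by simp
    finally show ?thesis .
  qed
  have "sqrt (58 * n / \<kappa>) \<le> sqrt (16\<^sup>2 / R)"
  proof (rule real_sqrt_le_mono)
    have "58 * n / \<kappa> \<le> 232 / R" using inv[of 58] by (simp add: mult.commute)
    also have "\<dots> \<le> 16\<^sup>2 / R" using R by (intro divide_right_mono) auto
    finally show "58 * n / \<kappa> \<le> 16\<^sup>2 / R" .
  qed
  then have a0: "sqrt (58 * n / \<kappa>) \<le> 16 / sqrt R" by (simp add: real_sqrt_divide)
  \<comment> \<open>Holds because 25/16 * 2/3 = 25/24 exceeds 1.\<close>
  have "1 / R \<le> (5/4)\<^sup>2 * (ln n / R)" using ln R by (simp add: field_simps power2_eq_square)
  then have "sqrt (1 / R) \<le> sqrt ((5/4)\<^sup>2 * (ln n / R))" by (rule real_sqrt_le_mono)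
  also have "\<dots> = 5/4 * r" unfolding r_def by (subst real_sqrt_mult) simp
  finally have Rr: "1 / sqrt R \<le> 5/4 * r" by (simp add: real_sqrt_divide)
  have "sqrt (6 * n * ln n / \<kappa>) \<le> sqrt (5\<^sup>2 * (ln n / R))"
  proof (rule real_sqrt_le_mono)
    have "6 * n * ln n / \<kappa> \<le> 24 * ln n / R" using inv[of "6 * ln n"] ln by (simp add: mult_ac)
    also have "\<dots> \<le> 5\<^sup>2 * (ln n / R)" using ln R by (simp add: divide_right_mono)
    finally show "6 * n * ln n / \<kappa> \<le> 5\<^sup>2 * (ln n / R)" .
  qed
  also have "\<dots> = 5 * r" unfolding r_def by (subst real_sqrt_mult) simp
  finally have \<rho>0: "sqrt (6 * n * ln n / \<kappa>) \<le> 5 * r" .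
  have \<beta>n: "\<beta> \<le> n * \<beta>" using mult_right_mono[of 1 "real n" \<beta>] n \<beta> by simp
  have r0: "r \<ge> 0" using ln R by (simp add: r_def)
  have sb: "sqrt b \<ge> 1" using b by simp
  have p7: "b powr (7/2) = b ^ 3 * sqrt b"
  proof -
    have "b powr (7/2) = b powr (real 3 + 1/2)" by simp
    also have "\<dots> = b ^ 3 * sqrt b" using b unfolding powr_add by (simp add: powr_realpow powr_half_sqrt del: of_nat_numeral)
    finally show ?thesis .
  qed
  have p9: "b powr (9/2) = b ^ 4 * sqrt b"
  proof -
    have "b powr (9/2) = b powr (real 4 + 1/2)" by simp
    also have "\<dots> = b ^ 4 * sqrt b" using b unfolding powr_add by (simp add: powr_realpow powr_half_sqrt del: of_nat_numeral)
    finally show ?thesis .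
  qed
  have s: "r + n * \<beta> \<le> 1 / (300 * (b ^ 3 * sqrt b))" using small by (simp add: r_def p7)
  \<comment> \<open>20 = 16 * 5/4 comes from \<open>a0\<close> and \<open>Rr\<close>. Together with
    the 5 of \<open>\<rho>0\<close> it gives 25, and 25 / 300 = 1 / 12 explains the constant of the
    smallness hypothesis.\<close>
  have "(sqrt (58 * n / \<kappa>) + \<beta>) * sqrt b \<le> (20 * (r + n * \<beta>)) * sqrt b"
    using a0 Rr \<beta>n \<beta> r0 sb by (intro mult_right_mono) (auto simp: algebra_simps)
  moreover have "sqrt (6 * n * ln n / \<kappa>) + \<beta> \<le> (5 * (r + n * \<beta>)) * 1" using \<rho>0 \<beta>n \<beta> by simp
  moreover have "(5 * (r + n * \<beta>)) * 1 \<le> (5 * (r + n * \<beta>)) * sqrt b"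
    using sb r0 \<beta> by (intro mult_left_mono) auto
  ultimately have "(sqrt (58 * n / \<kappa>) + \<beta>) * sqrt b + (sqrt (6 * n * ln n / \<kappa>) + \<beta>) \<le> 25 * sqrt b * (r + n * \<beta>)"
    by (simp add: algebra_simps)
  also have "\<dots> \<le> 25 * sqrt b * (1 / (300 * (b ^ 3 * sqrt b)))" using s b by (intro mult_left_mono) auto
  also have "\<dots> = 1 / (12 * b ^ 3)" using b by (simp add: field_simps)
  also have "\<dots> \<le> 1 / (12 * b)" using b self_le_power[of b 3] by (intro divide_left_mono) auto
  finally show "(sqrt (58 * n / \<kappa>) + \<beta>) * sqrt b + (sqrt (6 * n * ln n / \<kappa>) + \<beta>) \<le> 1 / (12 * b)" .
  have "24 * (b\<^sup>2 * sqrt b) * (sqrt (58 * n / \<kappa>) + \<beta>) \<le> 24 * (b\<^sup>2 * sqrt b) * (16 * (n * \<beta>) + 16 / sqrt R)"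
    using a0 \<beta>n \<beta> b by (intro mult_left_mono) auto
  also have "\<dots> = 384 * (n * \<beta> * (b\<^sup>2 * sqrt b) + (b\<^sup>2 * sqrt b) / sqrt R)" by (simp add: algebra_simps)
  \<comment> \<open>As b >= 1, the power 5/2 from the perturbation bound is enlarged to 7/2 and 9/2;
    384 = 24 * 16.\<close>
  also have "\<dots> \<le> 384 * (n * \<beta> * (b ^ 3 * sqrt b) + (b ^ 4 * sqrt b) / sqrt R)"
    using b \<beta> R by (intro mult_left_mono add_mono divide_right_mono mult_right_mono power_increasing) auto
  finally show "24 * (b\<^sup>2 * sqrt b) * (sqrt (58 * n / \<kappa>) + \<beta>) \<le> 384 * (n * \<beta> * b powr (7/2) + b powr (9/2) / sqrt R)"
    by (simp only: p7 p9)
qed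

text \<open>In units of n^(-10), the failure probability collects 1 from graphs in which some pair
  is compared too rarely, 2 from the column sums with either sign, and 10^10 from the net.\<close>

lemma btl_error_prob:
  fixes n T L :: nat and M t pmin b \<delta> d :: real and w :: "real \<Rightarrow> nat \<Rightarrow> real" and p :: "real \<Rightarrow> real"
  assumes n: "n \<ge> 2" and T: "T \<ge> 1" and L: "L \<ge> 1" and M: "M \<ge> 0"
    and w: "\<forall>s\<in>{0..1}. \<forall>i\<in>{1..n}. w s i > 0"
    and smooth: "\<forall>s\<in>{0..1}. \<forall>s'\<in>{0..1}. \<forall>i\<in>{1..n}. \<forall>j\<in>{1..n}. i \<noteq> j \<longrightarrow>
        \<bar>win_prob w s i j - win_prob w s' i j\<bar> \<le> M * \<bar>s - s'\<bar>"
    and p: "\<forall>s\<in>time_grid T. 0 \<le> p s \<and> p s \<le> 1"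
    and t: "t \<in> {0..1}"
    and pmin: "pmin = Min (p ` time_grid T)" "pmin > 0"
    and b: "b = cond_number n w t"
    and \<delta>: "\<delta> = bandwidth n T L M b pmin" "96 * (ln n / pmin) \<le> \<delta>"
    and d: "d = 3 * real n * union_prob T p \<delta> t"
    and small: "sqrt (ln n / (real L * real n * pmin)) * noise_rate n T L M b pmin
        + M * n * bias_rate n T L M b pmin \<le> 1 / 300 * (1 / b powr (7/2))"
  shows "measure_pmf.prob (btl_pmf n T L w p)
      {(G, z). let P = P_hat n T L d \<delta> t G z; \<pi> = the_stationary_distribution n P in
         (\<exists>!v. stationary_distribution n P v) \<and>
         L2_set (\<lambda>i. \<pi> i - pi_star n w t i) {1..n} / L2_set (pi_star n w t) {1..n}
           \<le> 384 * (M * n * b powr (7/2) * bias_rate n T L M b pmin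
                  + b powr (9/2) / sqrt (real L * real n * pmin) * noise_rate n T L M b pmin)}
    \<ge> 1 - (3 + 10 ^ 10) * (1 / real n ^ 10)"
    (is "measure_pmf.prob _ ?good \<ge> _")
proof -
  have b1: "b \<ge> 1" unfolding b by (rule cond_number_ge_1) (use n w t in auto)
  have pge: "pmin \<le> p s" if "s \<in> time_grid T" for s
    unfolding pmin using finite_time_grid that by (intro Min_le) auto
  have "0 \<in> time_grid T" by (auto simp: time_grid_def image_iff)
  then have pmin1: "pmin \<le> 1" using pge[of 0] p by force
  have ln: "2 / 3 \<le> ln (real n)"
  proof -
    have "ln 2 \<le> ln (real n)" using n by simp
    then show ?thesis using ln2_ge_two_thirds by linarith
  qed
  have \<delta>2: "2 \<le> \<delta>"
  proof -
    have "ln n * 1 \<le> ln n * (1 / pmin)" using ln pmin pmin1 by (intro mult_left_mono) auto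
    then show ?thesis using \<delta>(2) ln by simp
  qed
  have \<delta>T: "\<delta> \<le> T" unfolding \<delta>(1) by (simp add: bandwidth_def)
  define m where "m = real (card (nbhd T \<delta> t))"
  have m: "\<delta> / 2 \<le> m" unfolding m_def by (rule card_nbhd_ge[OF T \<delta>2 \<delta>T t])
  \<comment> \<open>This is where 96 = 2 * 4 * 12 is spent: the window may lose half of its length
    at the boundary of [0, 1], K is a quarter of the lower bound \<open>m * pmin\<close> for the
    expected count, and the union bound over pairs asks for \<open>12 * ln n\<close>.\<close>
  define K where "K = m * pmin / 4"
  have \<delta>p: "96 * ln n \<le> \<delta> * pmin" using \<delta>(2) pmin by (simp add: field_simps)
  have mp: "\<delta> * pmin / 2 \<le> m * pmin" using mult_right_mono[OF m, of pmin] pmin by simp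
  have K12: "12 * ln n \<le> K" using mp \<delta>p by (simp add: K_def)
  have K0: "K > 0" using K12 ln by linarith
  have "1 \<le> m * pmin" using mp \<delta>p ln by linarith
  then have up: "1 / 2 \<le> union_prob T p \<delta> t" "union_prob T p \<delta> t \<le> 1"
    using union_prob_bounds[of T p pmin \<delta> t] p pge unfolding m_def by auto
  have d1: "3 / 2 * n \<le> d" and d3: "d \<le> 3 * n"
    unfolding d using mult_left_mono[OF up(1), of "3 * real n"] mult_left_mono[OF up(2), of "3 * real n"] by auto
  have dn: "n \<le> d" and d0: "d > 0" using d1 n by auto
  define R where "R = real L * real n * pmin * \<delta>"
  have R: "R > 0" using L n pmin \<delta>2 by (simp add: R_def)
  define \<beta> where "\<beta> = M * (\<delta> / T)"
  have \<beta>: "\<beta> \<ge> 0" using M \<delta>2 by (simp add: \<beta>_def)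
  define \<kappa> where "\<kappa> = d\<^sup>2 * L * K"
  \<comment> \<open>From d >= 3 n / 2 and K >= \<delta> pmin / 8 comes the factor 9/4 * 1/8 = 9/32,
    which exceeds 1/4.\<close>
  have \<kappa>: "n * R / 4 \<le> \<kappa>"
  proof -
    have "n * R / 4 \<le> 9 / 4 * n\<^sup>2 * L * (\<delta> * pmin / 8)"
    proof -
      have "n * R / 4 = n\<^sup>2 * L * (\<delta> * pmin) * (1 / 4)" by (simp add: R_def power2_eq_square)
      also have "\<dots> \<le> n\<^sup>2 * L * (\<delta> * pmin) * (9 / 32)" using \<delta>2 pmin by (intro mult_left_mono) auto
      finally show ?thesis by simp
    qed
    also have "\<dots> \<le> d\<^sup>2 * L * K"
    proof (intro mult_mono)
      show "9 / 4 * real (n\<^sup>2) \<le> d\<^sup>2" using power_mono[OF d1, of 2] by (simp add: power_mult_distrib power_divide)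
      show "\<delta> * pmin / 8 \<le> K" using mp by (simp add: K_def)
    qed (use pmin \<delta>2 in auto)
    finally show ?thesis by (simp add: \<kappa>_def)
  qed
  have nr: "noise_rate n T L M b pmin = 1 / sqrt \<delta>"
    unfolding \<delta>(1) by (rule noise_rate_eq) (use T n L M b1 pmin in auto)
  have br: "bias_rate n T L M b pmin = \<delta> / T" unfolding \<delta>(1) by (rule bias_rate_eq[OF T])
  have sR: "sqrt (real L * real n * pmin) * sqrt \<delta> = sqrt R" by (simp add: R_def real_sqrt_mult)
  \<comment> \<open>Expressed through \<delta>, the hypothesis involves only R and \<beta>: the
    noise rate contributes the factor \<delta> in R, and the bias rate turns M into \<beta>.\<close>
  have small': "sqrt (ln n / R) + n * \<beta> \<le> 1 / 300 * (1 / b powr (7/2))"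
  proof -
    have "sqrt (ln n / (real L * real n * pmin)) * (1 / sqrt \<delta>) = sqrt (ln n / R)"
      by (simp add: real_sqrt_divide flip: sR)
    then show ?thesis using small unfolding nr br by (simp add: \<beta>_def mult_ac)
  qed
  note rates = rate_constants[OF n R \<beta> b1 \<kappa> small']
  have bound: "384 * (M * n * b powr (7/2) * (\<delta> / T) + b powr (9/2) / sqrt (real L * real n * pmin) * (1 / sqrt \<delta>))
      = 384 * (n * \<beta> * b powr (7/2) + b powr (9/2) / sqrt R)"
    by (simp add: \<beta>_def flip: sR)
  define D where "D = {G. \<exists>i\<in>{1..n}. \<exists>j\<in>{1..n}. i \<noteq> j \<and> card (edge_nbhd T G \<delta> t i j) < m * pmin / 4}"
  have "measure_pmf.prob (graphs_pmf n T p) D \<le> 1 / real n ^ 10"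
    unfolding D_def m_def using n p pge K12[unfolded K_def m_def] by (intro sparse_pair_prob) auto
  moreover have "measure_pmf.prob (map_pmf (\<lambda>z. (G, z)) (outcomes_pmf T L w G)) (- ?good)
      \<le> exp (- real n) + 2 / real n ^ 10" if G: "G \<in> set_pmf (graphs_pmf n T p)" "G \<notin> D" for G
  proof -
    have wg: "w s i > 0" if "s \<in> time_grid T" "i \<in> {1..n}" for s i
      using w that subsetD[OF time_grid_subset that(1)] by blast
    have GV: "G s \<subseteq> vertex_pairs n" if "s \<in> time_grid T" for s
      by (rule graphs_pmf_subset[OF G(1) that])
    have count: "K \<le> card (edge_nbhd T G \<delta> t i j)" if "i \<in> {1..n}" "j \<in> {1..n}" "i \<noteq> j" for i j
    proof -
      have "\<not> card (edge_nbhd T G \<delta> t i j) < m * pmin / 4" using G(2) that unfolding D_def by blast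
      then show ?thesis by (simp add: K_def)
    qed
    let ?E = "{z. \<not> ((\<forall>u v. bilinear_form {1..n} (sampling_noise T L w d \<delta> t G z) u v
                 \<le> sqrt (58 * n / \<kappa>) * (L2_set u {1..n} * L2_set v {1..n})) \<and>
              (\<forall>j\<in>{1..n}. \<bar>\<Sum>i\<in>{1..n}. sampling_noise T L w d \<delta> t G z i j\<bar> \<le> sqrt (6 * n * ln n / \<kappa>)))}"
    have "measure_pmf.prob (map_pmf (\<lambda>z. (G, z)) (outcomes_pmf T L w G)) (- ?good)
        = measure_pmf.prob (outcomes_pmf T L w G) ((\<lambda>z. (G, z)) -` (- ?good))" by (rule measure_map_pmf)
    also have "\<dots> \<le> measure_pmf.prob (outcomes_pmf T L w G) ?E"
    proof (rule measure_pmf.finite_measure_mono)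
      have "(G, z) \<in> ?good" if z: "z \<notin> ?E" for z
      proof -
        have "\<bar>win_prob w s i j - win_prob w t i j\<bar> \<le> \<beta>"
          if "s \<in> nbhd T \<delta> t" "i \<in> {1..n}" "j \<in> {1..n}" "i \<noteq> j" for s i j
        proof -
          have s: "s \<in> {0..1}" "\<bar>t - s\<bar> \<le> \<delta> / T" using that(1) subsetD[OF time_grid_subset, of s T] by (auto simp: nbhd_def)
          have "\<bar>win_prob w s i j - win_prob w t i j\<bar> \<le> M * \<bar>s - t\<bar>" by (rule smooth[rule_format, OF s(1) t that(2,3,4)])
          also have "\<dots> \<le> \<beta>" unfolding \<beta>_def using s(2) M by (intro mult_left_mono) (auto simp: abs_minus_commute)
          finally show ?thesis .
        qed
        note err = rank_centrality_error[of n L w t d T \<delta> \<beta> G z "sqrt (58 * n / \<kappa>)" "sqrt (6 * n * ln n / \<kappa>)",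
            OF _ L _ t dn d3 this \<beta>]
        have edges: "edge_nbhd T G \<delta> t i j \<noteq> {}" if "i \<in> {1..n}" "j \<in> {1..n}" "i \<noteq> j" for i j
          using count[OF that] K0 by auto
        have sqrt0: "0 \<le> sqrt (58 * n / \<kappa>)" using d0 K0 by (simp add: \<kappa>_def)
        have ex: "\<exists>!v. stationary_distribution n (P_hat n T L d \<delta> t G z) v"
          by (rule err(1)) (use n w edges z sqrt0 rates(1) in \<open>auto simp: b\<close>)
        have "L2_set (\<lambda>i. the_stationary_distribution n (P_hat n T L d \<delta> t G z) i - pi_star n w t i) {1..n} / L2_set (pi_star n w t) {1..n}
            \<le> 24 * ((cond_number n w t)\<^sup>2 * sqrt (cond_number n w t)) * (sqrt (58 * n / \<kappa>) + \<beta>)"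
          by (rule err(2)) (use n w edges z sqrt0 rates(1) in \<open>auto simp: b\<close>)
        also have "\<dots> \<le> 384 * (n * \<beta> * b powr (7/2) + b powr (9/2) / sqrt R)"
          using rates(2) by (simp only: b)
        finally show ?thesis using ex unfolding nr br bound by (simp add: Let_def)
      qed
      then show "(\<lambda>z. (G, z)) -` (- ?good) \<subseteq> ?E" by blast
    qed simp
    also have "\<dots> \<le> exp (- real n) + 2 / real n ^ 10"
      unfolding \<kappa>_def by (rule noise_concentration[OF n wg L d0 K0 GV count])
    finally show ?thesis .
  qed
  ultimately have "measure_pmf.prob (btl_pmf n T L w p) (- ?good)
      \<le> 1 / real n ^ 10 + (exp (- real n) + 2 / real n ^ 10)"
    unfolding btl_pmf_def
    by (intro order_trans[OF prob_bind_pmf_le[where D = D and e = "exp (- real n) + 2 / real n ^ 10"]]) auto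
  also have "\<dots> \<le> 1 / real n ^ 10 + (10 ^ 10 / real n ^ 10 + 2 / real n ^ 10)"
    using exp_minus_le_inverse_power[of n] n by simp
  also have "\<dots> = (3 + 10 ^ 10) * (1 / real n ^ 10)" by (simp add: add_divide_distrib)
  finally have "measure_pmf.prob (btl_pmf n T L w p) (- ?good) \<le> (3 + 10 ^ 10) * (1 / real n ^ 10)" .
  then show ?thesis using measure_pmf.prob_compl[of ?good "btl_pmf n T L w p"] by (simp add: Compl_eq_Diff_UNIV)
qed

theorem corollary1:
  "\<exists>c0 > (0::real). \<exists>c1 > (0::real). \<exists>c2 > (0::real). \<exists>C > (0::real). \<exists>C' > (0::real).
   \<forall>(n::nat) (T::nat) (L::nat) (M::real) (w :: real \<Rightarrow> nat \<Rightarrow> real) (p :: real \<Rightarrow> real) (t::real).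
     n \<ge> 2 \<longrightarrow> T \<ge> 1 \<longrightarrow> L \<ge> 1 \<longrightarrow> M \<ge> 0 \<longrightarrow>
     (\<forall>s\<in>{0..1}. \<forall>i\<in>{1..n}. w s i > 0) \<longrightarrow>
     (\<forall>s\<in>{0..1}. \<forall>s'\<in>{0..1}. \<forall>i\<in>{1..n}. \<forall>j\<in>{1..n}. i \<noteq> j \<longrightarrow>
        \<bar>win_prob w s i j - win_prob w s' i j\<bar> \<le> M * \<bar>s - s'\<bar>) \<longrightarrow>
     (\<forall>s\<in>time_grid T. 0 \<le> p s \<and> p s \<le> 1) \<longrightarrow>
     t \<in> {0..1} \<longrightarrow>
     (let pmin = Min (p ` time_grid T);
          b = cond_number n w t;
          \<delta> = bandwidth n T L M b pmin;
          d = 3 * real n * union_prob T p \<delta> t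
      in pmin > 0 \<longrightarrow>
         real n \<ge> c0 * ln (real n) \<longrightarrow>
         \<delta> \<ge> c1 * (ln (real n) / pmin) \<longrightarrow>
         sqrt (ln (real n) / (real L * real n * pmin)) * noise_rate n T L M b pmin
           + M * real n * bias_rate n T L M b pmin \<le> c2 * (1 / b powr (7/2)) \<longrightarrow>
         measure_pmf.prob (btl_pmf n T L w p)
           {(G, z). let P = P_hat n T L d \<delta> t G z; \<pi> = the_stationary_distribution n P in
              (\<exists>!v. stationary_distribution n P v) \<and>
              L2_set (\<lambda>i. \<pi> i - pi_star n w t i) {1..n} / L2_set (pi_star n w t) {1..n}
                \<le> C * (M * real n * b powr (7/2) * bias_rate n T L M b pmin
                       + b powr (9/2) / sqrt (real L * real n * pmin) * noise_rate n T L M b pmin)}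
         \<ge> 1 - C' * (1 / real n ^ 10))"
proof (rule exI[of _ 1], rule conjI, simp, rule exI[of _ 96], rule conjI, simp, rule exI[of _ "1 / 300"], rule conjI,
    simp, rule exI[of _ 384], rule conjI, simp, rule exI[of _ "3 + 10 ^ 10"], rule conjI, simp, intro allI impI)
  fix n T L :: nat and M :: real and w :: "real \<Rightarrow> nat \<Rightarrow> real" and p :: "real \<Rightarrow> real" and t :: real
  assume "n \<ge> 2" "T \<ge> 1" "L \<ge> 1" "M \<ge> 0" "\<forall>s\<in>{0..1}. \<forall>i\<in>{1..n}. w s i > 0"
    "\<forall>s\<in>{0..1}. \<forall>s'\<in>{0..1}. \<forall>i\<in>{1..n}. \<forall>j\<in>{1..n}. i \<noteq> j \<longrightarrow>
        \<bar>win_prob w s i j - win_prob w s' i j\<bar> \<le> M * \<bar>s - s'\<bar>"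
    "\<forall>s\<in>time_grid T. 0 \<le> p s \<and> p s \<le> 1" "t \<in> {0..1}"
  note error_prob = btl_error_prob[OF this refl _ refl refl _ refl, unfolded Let_def]
  show "(let pmin = Min (p ` time_grid T);
          b = cond_number n w t;
          \<delta> = bandwidth n T L M b pmin;
          d = 3 * real n * union_prob T p \<delta> t
      in pmin > 0 \<longrightarrow>
         real n \<ge> 1 * ln (real n) \<longrightarrow>
         \<delta> \<ge> 96 * (ln (real n) / pmin) \<longrightarrow>
         sqrt (ln (real n) / (real L * real n * pmin)) * noise_rate n T L M b pmin
           + M * real n * bias_rate n T L M b pmin \<le> 1 / 300 * (1 / b powr (7/2)) \<longrightarrow>
         measure_pmf.prob (btl_pmf n T L w p)
           {(G, z). let P = P_hat n T L d \<delta> t G z; \<pi> = the_stationary_distribution n P in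
              (\<exists>!v. stationary_distribution n P v) \<and>
              L2_set (\<lambda>i. \<pi> i - pi_star n w t i) {1..n} / L2_set (pi_star n w t) {1..n}
                \<le> 384 * (M * real n * b powr (7/2) * bias_rate n T L M b pmin
                       + b powr (9/2) / sqrt (real L * real n * pmin) * noise_rate n T L M b pmin)}
         \<ge> 1 - (3 + 10 ^ 10) * (1 / real n ^ 10))"
    unfolding Let_def by (intro impI error_prob)
qed

end
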